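(* Let $\Phi\ge 2$ be a Markoff map taking the value $2$ on exactly one region $R=R_\infty$, so that there is a real $y>1$ with $\Phi(R_n)=2y$ for all $n\in\mathbb{Z}$, where $(R_n)_{n\in\mathbb{Z}}$ are the regions adjacent to $R$. Let $\Pi\subset\mathbb{P}^2\mathbb{R}$ be the set of projective classes of infinitesimal deformations $\Phi'$ of $\Phi$ with $\Phi'(R_s)>0$ for every $s\in\mathbb{P}^1\mathbb{Q}$, and for $n\in\mathbb{Z}$ let the $R_n$-edge of $\Pi$ be $\{[\Phi']\in\overline{\Pi} : \Phi'(R_n)=0\}$. Let $r\in\mathbb{P}^2\mathbb{R}$ be the point given by the deformation with $\Phi'(R)=0$ and $\Phi'(R_n)=1$ for all $n\in\mathbb{Z}$ (to which the $R$-edge of $\Pi$ is collapsed). Then all the $R_n$-edges (for $n\in\mathbb{Z}$) have their endpoints on a conic through $r$. Moreover, all these edges are tangent to a second conic, which intersects the first one at $r$ with a contact of order $4$.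
   Context: Farey neighbors: two rationals $\frac pq,\frac{p'}{q'}\in\mathbb{P}^1\mathbb{Q}=\mathbb{Q}\cup\{\infty\}$ in reduced form (with $\infty=\frac10$) are Farey neighbors if $|pq'-qp'|=1$. Let $\mathcal{R}=\{R_{p/q}\}$ be the set of complementary regions of the trivalent tree in $\mathbb{H}^2$ dual to the Farey triangulation, indexed by $\mathbb{P}^1\mathbb{Q}$; two regions are adjacent iff their indices are Farey neighbors. In particular the regions adjacent to $R_\infty$ are the $R_n$, $n\in\mathbb{Z}$. (The group $\mathrm{PSL}_2(\mathbb{Z})$ acts on everything, so placing the exceptional region at $R_\infty$ is just a choice of marking.) A Markoff map is a map $\Phi:\mathcal{R}\to\mathbb{R}$ such that whenever $R,R',R'',R'''$ are distinct regions with every pair among them adjacent except $\{R,R'''\}$, one has $\Phi(R)+\Phi(R''')=\Phi(R')\Phi(R'')$. An infinitesimal deformation of $\Phi$ is a map $\Phi':\mathcal{R}\to\mathbb{R}$ satisfying the linearized relation $\Phi'(R)+\Phi'(R''')=\Phi'(R')\Phi(R'')+\Phi(R')\Phi'(R'')$ for all such $R,R',R'',R'''$; these form a $3$-dimensional vector space, parametrized by $(\Phi'(R_\infty),\Phi'(R_0),\Phi'(R_1))\in\mathbb{R}^3$, whose projectivization is identified with $\mathbb{P}^2\mathbb{R}$. Conics are nondegenerate real conics in $\mathbb{P}^2\mathbb{R}$. Two conics have contact of order $4$ at a point if their intersection multiplicity there is $4$ (the highest possible for distinct conics). An edge (a segment) is tangent to a conic if the line supporting it is tangent to the conic. *)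

theory Defs
  imports "HOL-Analysis.Analysis" "HOL-Computational_Algebra.Computational_Algebra"
begin

text \<open>The regions \<open>R\<^sub>s\<close> are identified with their indices \<open>s\<close> in the projective line over the
  rationals.\<close>

datatype slope = Fin rat | Infty

fun slope_num :: "slope \<Rightarrow> int" where
  "slope_num (Fin x) = fst (quotient_of x)"
| "slope_num Infty = 1"

fun slope_den :: "slope \<Rightarrow> int" where
  "slope_den (Fin x) = snd (quotient_of x)"
| "slope_den Infty = 0"

definition int_slope :: "int \<Rightarrow> slope" where
  "int_slope n = Fin (of_int n)"

definition adjacent :: "slope \<Rightarrow> slope \<Rightarrow> bool" where
  "adjacent s t \<longleftrightarrow> \<bar>slope_num s * slope_den t - slope_den s * slope_num t\<bar> = 1"

definition adjacent_except_ends :: "slope \<Rightarrow> slope \<Rightarrow> slope \<Rightarrow> slope \<Rightarrow> bool" where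
  "adjacent_except_ends R R' R'' R''' \<longleftrightarrow>
     distinct [R, R', R'', R'''] \<and>
     adjacent R R' \<and> adjacent R R'' \<and> adjacent R' R'' \<and> adjacent R' R''' \<and> adjacent R'' R''' \<and>
     \<not> adjacent R R'''"

definition markoff_map :: "(slope \<Rightarrow> real) \<Rightarrow> bool" where
  "markoff_map \<Phi> \<longleftrightarrow>
     (\<forall>R R' R'' R'''. adjacent_except_ends R R' R'' R''' \<longrightarrow> \<Phi> R + \<Phi> R''' = \<Phi> R' * \<Phi> R'')"

definition inf_deformation :: "(slope \<Rightarrow> real) \<Rightarrow> (slope \<Rightarrow> real) \<Rightarrow> bool" where
  "inf_deformation \<Phi> \<phi> \<longleftrightarrow>
     (\<forall>R R' R'' R'''. adjacent_except_ends R R' R'' R''' \<longrightarrow>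
        \<phi> R + \<phi> R''' = \<phi> R' * \<Phi> R'' + \<Phi> R' * \<phi> R'')"

text \<open>The real projective plane, as the set of lines through the origin of \<open>\<real>\<^sup>3\<close>, with the quotient
  topology. The value \<open>proj 0\<close> is meaningless.\<close>

typedef rp2 = "{L :: (real ^ 3) set. subspace L \<and> dim L = 1}"
  by (rule exI[of _ "span {axis 1 1}"]) (simp add: dim_eq_card_independent axis_eq_0_iff)

definition proj :: "real ^ 3 \<Rightarrow> rp2" where
  "proj v = Abs_rp2 (span {v})"

instantiation rp2 :: topological_space
begin

definition open_rp2 :: "rp2 set \<Rightarrow> bool" where
  "open_rp2 U \<longleftrightarrow> open {v. v \<noteq> 0 \<and> proj v \<in> U}"

instance
proof
  have "{v::real^3. v \<noteq> 0 \<and> proj v \<in> UNIV} = - {0}" by auto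
  moreover have "open (- {0 :: real ^ 3})" by (rule open_Compl) (rule closed_singleton)
  ultimately show "open (UNIV :: rp2 set)" by (simp only: open_rp2_def)
next
  fix S T :: "rp2 set" assume "open S" "open T"
  moreover have "{v. v \<noteq> 0 \<and> proj v \<in> S \<inter> T} =
      {v. v \<noteq> 0 \<and> proj v \<in> S} \<inter> {v. v \<noteq> 0 \<and> proj v \<in> T}" by auto
  ultimately show "open (S \<inter> T)" by (simp only: open_rp2_def open_Int)
next
  fix K :: "rp2 set set" assume "\<forall>S\<in>K. open S"
  moreover have "{v. v \<noteq> 0 \<and> proj v \<in> \<Union>K} = (\<Union>S\<in>K. {v. v \<noteq> 0 \<and> proj v \<in> S})" by auto
  ultimately show "open (\<Union>K)" by (simp only: open_rp2_def open_UN)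
qed

end

definition deform_coords :: "(slope \<Rightarrow> real) \<Rightarrow> real ^ 3" where
  "deform_coords \<phi> = vector [\<phi> Infty, \<phi> (int_slope 0), \<phi> (int_slope 1)]"

definition deform_class :: "(slope \<Rightarrow> real) \<Rightarrow> rp2" where
  "deform_class \<phi> = proj (deform_coords \<phi>)"

definition positive_deformations :: "(slope \<Rightarrow> real) \<Rightarrow> rp2 set" where
  "positive_deformations \<Phi> = {deform_class \<phi> | \<phi>. inf_deformation \<Phi> \<phi> \<and> (\<forall>s. \<phi> s > 0)}"

definition region_edge :: "(slope \<Rightarrow> real) \<Rightarrow> slope \<Rightarrow> rp2 set" where
  "region_edge \<Phi> s =
     {deform_class \<phi> | \<phi>. inf_deformation \<Phi> \<phi> \<and> deform_coords \<phi> \<noteq> 0 \<and>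
        deform_class \<phi> \<in> closure (positive_deformations \<Phi>) \<and> \<phi> s = 0}"

text \<open>Two distinct points of a projective line bound two segments; the choice between them is the
  choice of the relative sign of the representatives \<open>u\<close> and \<open>v\<close>.\<close>

definition segment_with_endpoints :: "rp2 set \<Rightarrow> rp2 \<Rightarrow> rp2 \<Rightarrow> bool" where
  "segment_with_endpoints S p q \<longleftrightarrow> p \<noteq> q \<and>
     (\<exists>u v. u \<noteq> 0 \<and> v \<noteq> 0 \<and> p = proj u \<and> q = proj v \<and>
        S = {proj (a *\<^sub>R u + b *\<^sub>R v) | a b. a \<ge> 0 \<and> b \<ge> 0 \<and> (a \<noteq> 0 \<or> b \<noteq> 0)})"

definition line_through :: "rp2 \<Rightarrow> rp2 \<Rightarrow> rp2 set" where
  "line_through p q = {x. Rep_rp2 x \<subseteq> span (Rep_rp2 p \<union> Rep_rp2 q)}"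

text \<open>A conic is given by the matrix of its quadratic form.\<close>

definition nondegenerate_conic :: "real ^ 3 ^ 3 \<Rightarrow> bool" where
  "nondegenerate_conic A \<longleftrightarrow> transpose A = A \<and> det A \<noteq> 0"

definition conic_points :: "real ^ 3 ^ 3 \<Rightarrow> rp2 set" where
  "conic_points A = {proj v | v. v \<noteq> 0 \<and> v \<bullet> (A *v v) = 0}"

text \<open>The tangent line to the conic at \<open>proj v\<close> is the kernel of the differential
  \<open>w \<mapsto> 2 (w \<bullet> A v)\<close> of the quadratic form at \<open>v\<close>.\<close>

definition tangent_to_conic :: "rp2 set \<Rightarrow> real ^ 3 ^ 3 \<Rightarrow> bool" where
  "tangent_to_conic L A \<longleftrightarrow>
     (\<exists>v. v \<noteq> 0 \<and> v \<bullet> (A *v v) = 0 \<and> L = {proj w | w. w \<noteq> 0 \<and> w \<bullet> (A *v v) = 0})"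

text \<open>Polynomials in two variables \<open>x\<close>, \<open>y\<close> are elements of \<open>\<real>[x][y]\<close>, so \<open>x\<close> is the inner
  variable. The local ring of the affine plane at the origin consists of the rational functions
  defined there, and the intersection multiplicity of the curves \<open>f = 0\<close> and \<open>g = 0\<close> at the origin
  is the real dimension of its quotient by the ideal generated by \<open>f\<close> and \<open>g\<close>. It equals \<open>m\<close> iff
  there are elements \<open>b 0, \<dots>, b (m - 1)\<close> whose classes form a basis of this quotient.\<close>

definition local_ring_origin :: "real poly poly fract set" where
  "local_ring_origin = {Fract f g | f g. poly (poly g 0) 0 \<noteq> 0}"

definition local_ideal :: "real poly poly \<Rightarrow> real poly poly \<Rightarrow> real poly poly fract set" where
  "local_ideal f g =
     {h * Fract f 1 + k * Fract g 1 | h k. h \<in> local_ring_origin \<and> k \<in> local_ring_origin}"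

definition intersection_multiplicity_origin ::
    "real poly poly \<Rightarrow> real poly poly \<Rightarrow> nat \<Rightarrow> bool" where
  "intersection_multiplicity_origin f g m \<longleftrightarrow>
     (\<exists>b :: nat \<Rightarrow> real poly poly fract.
        (\<forall>i<m. b i \<in> local_ring_origin) \<and>
        (\<forall>h\<in>local_ring_origin. \<exists>!c :: nat \<Rightarrow> real.
           (\<forall>i\<ge>m. c i = 0) \<and> h - (\<Sum>i<m. Fract [:[:c i:]:] 1 * b i) \<in> local_ideal f g))"

text \<open>The equation of the conic in the affine chart \<open>(x, y) \<mapsto> proj (x u + y w + v)\<close>, whose origin
  is \<open>proj v\<close>.\<close>

definition conic_chart_equation ::
    "real ^ 3 ^ 3 \<Rightarrow> real ^ 3 \<Rightarrow> real ^ 3 \<Rightarrow> real ^ 3 \<Rightarrow> real poly poly" where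
  "conic_chart_equation A u w v =
     (let X = (\<lambda>i. [:[:v $ i, u $ i:], [:w $ i:]:])
      in \<Sum>i\<in>UNIV. \<Sum>j\<in>UNIV. [:[:A $ i $ j:]:] * X i * X j)"

text \<open>The intersection multiplicity at a point is computed in an affine chart centred there; it does
  not depend on the chart.\<close>

definition conic_intersection_multiplicity ::
    "real ^ 3 ^ 3 \<Rightarrow> real ^ 3 ^ 3 \<Rightarrow> rp2 \<Rightarrow> nat \<Rightarrow> bool" where
  "conic_intersection_multiplicity A B p m \<longleftrightarrow>
     (\<exists>u w v. det (vector [u, w, v] :: real ^ 3 ^ 3) \<noteq> 0 \<and> p = proj v \<and>
        intersection_multiplicity_origin
          (conic_chart_equation A u w v) (conic_chart_equation B u w v) m)"

end

(* Regions correspond to primitive vectors v of Z^2 up to sign, and the relations become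
   f(v + w) + f(v - w) = f(v) g(w) + g(v) f(w) for bases v, w. Along the neighbours of R every
   deformation is a quadratic polynomial a y n^2 + b n + c, and along those of R_n a deformation that
   vanishes on R_n is A lambda^k + B lambda^-k with 2 y = lambda + 1/lambda. Such a deformation is a
   limit of positive ones (up to sign) iff A, B >= 0: since the Markoff map is at least 2, nonnegativity
   on the neighbours propagates outwards. So the R_n-edge has endpoints A = 0 and B = 0, at which the
   discriminant b^2 - 4 y a c equals (y^2 - 1) a^2. The line supporting the edge consists of the
   quadratics with root n, hence is tangent to the conic of discriminant 0. The two conics span a
   pencil with the double line a^2 = 0, which is tangent to both at r: contact of order 4. *)
theory Submission imports Defs begin

section \<open>Slopes and primitive integer vectors\<close>

text \<open>A projective class can be handled through vectors only once every vector of R^3 is known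
  to be the coordinates of a deformation. Moving outwards in the tree determines the values, but the
  relation must then be checked for all bases of Z^2. The check is made for the nonlinear relation
  over an arbitrary commutative ring; polynomial coefficients turn it into the linearized one.
  Projective classes see positivity only up to a common sign, so limits of positive deformations are
  detected by products of two values. Conversely, a nonnegative deformation has to be approximated
  by strictly positive ones. The deformation representing r is at least 1 off R and vanishes on R,
  so adding a small multiple of it repairs every zero except one at R; for r itself, a nonnegative
  deformation with value 1 at R does the repair.\<close>

definition slope_of :: "int \<Rightarrow> int \<Rightarrow> slope" where
  "slope_of p q = (if q = 0 then Infty else Fin (Rat.Fract p q))"

lemma slope_of_minus [simp]: "slope_of (- p) (- q) = slope_of p q"
  by (simp add: slope_of_def eq_rat)

lemma slope_of_num_den [simp]: "slope_of (slope_num s) (slope_den s) = s"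
proof (cases s)
  case (Fin x)
  have "snd (quotient_of x) > 0" by (rule quotient_of_denom_pos')
  then show ?thesis by (simp add: Fin slope_of_def)
qed (simp add: slope_of_def)

lemma coprime_num_den: "coprime (slope_num s) (slope_den s)"
  by (cases s) (auto intro: quotient_of_coprime[OF surjective_pairing])

lemma num_den_slope_of:
  assumes "coprime p q"
  shows "slope_num (slope_of p q) = p \<and> slope_den (slope_of p q) = q \<or>
    slope_num (slope_of p q) = - p \<and> slope_den (slope_of p q) = - q"
proof (cases "q = 0")
  case True
  then have "\<bar>p\<bar> = 1" using assms by simp
  then show ?thesis using True by (auto simp: slope_of_def)
next
  case False
  have g: "gcd p q = 1" using assms by simp
  show ?thesis using False g
    by (cases "q > 0") (auto simp: slope_of_def quotient_of_Fract Rat.normalize_def Let_def)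
qed

lemma slope_obtain:
  obtains p q where "coprime p q" "q \<ge> 0" "s = slope_of p q"
proof (rule that)
  show "slope_den s \<ge> 0"
    by (cases s) (use quotient_of_denom_pos' in \<open>auto simp: less_imp_le\<close>)
  show "coprime (slope_num s) (slope_den s)" by (rule coprime_num_den)
qed simp

lemma int_slope_eq: "int_slope n = slope_of n 1"
  by (simp add: int_slope_def slope_of_def of_int_rat)

lemma Infty_eq: "Infty = slope_of 1 0"
  by (simp add: slope_of_def)

lemma adjacent_slope_of:
  assumes "coprime a b" "coprime c d"
  shows "adjacent (slope_of a b) (slope_of c d) \<longleftrightarrow> \<bar>a * d - b * c\<bar> = 1"
  using num_den_slope_of[OF assms(1)] num_den_slope_of[OF assms(2)]
  by (auto simp: adjacent_def)

lemma slope_of_eq_iff: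
  assumes "coprime a b" "coprime c d"
  shows "slope_of a b = slope_of c d \<longleftrightarrow> a = c \<and> b = d \<or> a = - c \<and> b = - d"
proof
  assume "slope_of a b = slope_of c d"
  then show "a = c \<and> b = d \<or> a = - c \<and> b = - d"
    using num_den_slope_of[OF assms(1)] num_den_slope_of[OF assms(2)] by auto
qed auto

lemma coprime_if_det:
  fixes a b c d :: int
  assumes "\<bar>a * d - b * c\<bar> = 1"
  shows "coprime a b" "coprime c d" "coprime (a + c) (b + d)" "coprime (a - c) (b - d)"
proof -
  have *: "coprime x y" if "x * t - y * z = 1 \<or> x * t - y * z = -1" for x y z t :: int
  proof (rule coprimeI)
    fix e assume "e dvd x" "e dvd y"
    then have "e dvd x * t - y * z" by simp
    then show "is_unit e" using that by auto
  qed
  have D: "a * d - b * c = 1 \<or> a * d - b * c = -1" using assms by linarith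
  show "coprime a b" by (rule *[of _ d _ c]) (use D in auto)
  show "coprime c d" by (rule *[of _ "-b" _ "-a"]) (use D in \<open>auto simp: algebra_simps\<close>)
  show "coprime (a + c) (b + d)" by (rule *[of _ "d" _ "c"]) (use D in \<open>auto simp: algebra_simps\<close>)
  show "coprime (a - c) (b - d)" by (rule *[of _ "d" _ "c"]) (use D in \<open>auto simp: algebra_simps\<close>)
qed

text \<open>The determinant of v - w and v + w is twice that of v and w, so the two ends are not
  adjacent, while every other pair is again a basis.\<close>

lemma adjacent_except_endsI:
  assumes D: "\<bar>a * d - b * c\<bar> = 1"
  shows "adjacent_except_ends (slope_of (a - c) (b - d)) (slope_of a b) (slope_of c d)
    (slope_of (a + c) (b + d))"
proof -
  note cop = coprime_if_det[OF D]
  have e: "a * d - b * c = 1 \<or> a * d - b * c = -1" using D by linarith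
  have n: "\<not> (a = c \<and> b = d)" "\<not> (a = - c \<and> b = - d)" "\<not> (a = 0 \<and> b = 0)" "\<not> (c = 0 \<and> d = 0)"
    using e by auto
  have 1: "(a - c) * b - (b - d) * a = a * d - b * c" "(a - c) * d - (b - d) * c = a * d - b * c"
    "a * (b + d) - b * (a + c) = a * d - b * c" "c * (b + d) - d * (a + c) = - (a * d - b * c)"
    "(a - c) * (b + d) - (b - d) * (a + c) = 2 * (a * d - b * c)" by algebra+
  have ad: "adjacent (slope_of (a - c) (b - d)) (slope_of a b)"
    "adjacent (slope_of (a - c) (b - d)) (slope_of c d)"
    "adjacent (slope_of a b) (slope_of c d)"
    "adjacent (slope_of a b) (slope_of (a + c) (b + d))"
    "adjacent (slope_of c d) (slope_of (a + c) (b + d))"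
    "\<not> adjacent (slope_of (a - c) (b - d)) (slope_of (a + c) (b + d))"
    using D by (simp_all add: adjacent_slope_of cop 1 abs_mult)
  have irr: "\<not> adjacent s s" for s by (simp add: adjacent_def)
  have "slope_of (a - c) (b - d) \<noteq> slope_of (a + c) (b + d)"
    using n by (auto simp: slope_of_eq_iff cop)
  then show ?thesis using ad irr unfolding adjacent_except_ends_def by auto
qed

text \<open>A vector whose determinants with v and w are both 1 or -1 has coordinates 1 or -1 in the
  basis v, w. Up to sign it is v + w or v - w, and the two distinct ends exhaust these
  possibilities.\<close>

lemma adjacent_except_endsE:
  assumes "adjacent_except_ends R R' R'' R'''"
  obtains a b c d where "\<bar>a * d - b * c\<bar> = 1" "R' = slope_of a b" "R'' = slope_of c d"
    "R = slope_of (a - c) (b - d)" "R''' = slope_of (a + c) (b + d)"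
proof -
  obtain a b where v: "coprime a b" "R' = slope_of a b" by (rule slope_obtain)
  obtain c d where w: "coprime c d" "R'' = slope_of c d" by (rule slope_obtain)
  have D: "\<bar>a * d - b * c\<bar> = 1"
    using assms v w by (simp add: adjacent_except_ends_def adjacent_slope_of)
  have *: "S = slope_of (a - c) (b - d) \<or> S = slope_of (a + c) (b + d)"
    if ad: "adjacent R' S" "adjacent R'' S" for S
  proof -
    obtain p q where S: "coprime p q" "S = slope_of p q" by (rule slope_obtain)
    define \<alpha> \<beta> E where "\<alpha> = c * q - d * p" and "\<beta> = a * q - b * p" and "E = a * d - b * c"
    have "\<bar>\<alpha>\<bar> = 1" "\<bar>\<beta>\<bar> = 1"
      using ad v w S by (simp_all add: adjacent_slope_of \<alpha>_def \<beta>_def)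
    then have ab: "\<alpha> = 1 \<or> \<alpha> = -1" "\<beta> = 1 \<or> \<beta> = -1" by linarith+
    have E: "E = 1 \<or> E = -1" using D unfolding E_def by linarith
    have "E * p = \<beta> * c - \<alpha> * a" "E * q = \<beta> * d - \<alpha> * b"
      unfolding \<alpha>_def \<beta>_def E_def by algebra+
    then have "(p = a - c \<and> q = b - d) \<or> (p = - (a - c) \<and> q = - (b - d)) \<or>
      (p = a + c \<and> q = b + d) \<or> (p = - (a + c) \<and> q = - (b + d))"
      using ab E by auto
    then show ?thesis using S(2) slope_of_minus by metis
  qed
  have sym: "adjacent s t \<Longrightarrow> adjacent t s" for s t
    unfolding adjacent_def by (metis abs_minus_commute mult.commute)
  have R: "R = slope_of (a - c) (b - d) \<or> R = slope_of (a + c) (b + d)"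
    "R''' = slope_of (a - c) (b - d) \<or> R''' = slope_of (a + c) (b + d)" "R \<noteq> R'''"
    using assms *[of R] *[of R'''] sym[of R] by (simp_all add: adjacent_except_ends_def)
  then consider "R = slope_of (a - c) (b - d)" "R''' = slope_of (a + c) (b + d)"
    | "R''' = slope_of (a - c) (b - d)" "R = slope_of (a + c) (b + d)" by auto
  then show thesis
  proof cases
    case 1
    then show ?thesis using that D v w by blast
  next
    case 2
    \<comment> \<open>Replacing w by - w keeps its region and exchanges v - w with v + w.\<close>
    have "\<bar>a * (- d) - b * (- c)\<bar> = 1" using D by (simp add: abs_minus_commute)
    moreover have "R'' = slope_of (- c) (- d)" using w by simp
    ultimately show ?thesis using that[of a "- d" b "- c"] 2 v by simp
  qed
qed

text \<open>An arbitrary \<open>P\<close> lets the Markoff relation and its linearization be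
  translated to bases of Z^2 by one argument.\<close>

lemma all_adjacent_except_ends_iff:
  "(\<forall>R R' R'' R'''. adjacent_except_ends R R' R'' R''' \<longrightarrow> P R R' R'' R''') \<longleftrightarrow>
   (\<forall>a b c d. \<bar>a * d - b * c\<bar> = 1 \<longrightarrow>
     P (slope_of (a - c) (b - d)) (slope_of a b) (slope_of c d) (slope_of (a + c) (b + d)))"
  (is "?l \<longleftrightarrow> ?r")
proof
  assume ?l
  then show ?r using adjacent_except_endsI by blast
next
  assume r: ?r
  show ?l
  proof (intro allI impI)
    fix R R' R'' R'''
    assume "adjacent_except_ends R R' R'' R'''"
    then obtain a b c d where "\<bar>a * d - b * c\<bar> = 1" "R' = slope_of a b" "R'' = slope_of c d"
      "R = slope_of (a - c) (b - d)" "R''' = slope_of (a + c) (b + d)"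
      by (rule adjacent_except_endsE)
    then show "P R R' R'' R'''" using r by simp
  qed
qed

lemma markoff_map_iff:
  "markoff_map \<Phi> \<longleftrightarrow> (\<forall>a b c d. \<bar>a * d - b * c\<bar> = 1 \<longrightarrow>
     \<Phi> (slope_of (a - c) (b - d)) + \<Phi> (slope_of (a + c) (b + d)) =
     \<Phi> (slope_of a b) * \<Phi> (slope_of c d))"
  unfolding markoff_map_def by (rule all_adjacent_except_ends_iff)

lemma inf_deformation_iff:
  "inf_deformation \<Phi> \<phi> \<longleftrightarrow> (\<forall>a b c d. \<bar>a * d - b * c\<bar> = 1 \<longrightarrow>
     \<phi> (slope_of (a - c) (b - d)) + \<phi> (slope_of (a + c) (b + d)) =
     \<phi> (slope_of a b) * \<Phi> (slope_of c d) + \<Phi> (slope_of a b) * \<phi> (slope_of c d))"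
  unfolding inf_deformation_def by (rule all_adjacent_except_ends_iff)

text \<open>Subtractive Euclidean algorithm: the coprime nonnegative combinations of \<open>v = (a, b)\<close> and
  \<open>w = (c, d)\<close> are reached from the pair \<open>v, w\<close> by replacing one of its members by \<open>v + w\<close>.\<close>

lemma cone_induct:
  fixes m n :: nat and a b c d :: int
  assumes "Q a b c d" and "coprime m n"
    and "\<And>a b c d. Q a b c d \<Longrightarrow> Q a b (a + c) (b + d) \<and> Q (a + c) (b + d) c d"
    and "\<And>a b c d. Q a b c d \<Longrightarrow> P a b \<and> P c d"
  shows "P (int m * a + int n * c) (int m * b + int n * d)"
  using assms(1,2)
proof (induction "m + n" arbitrary: m n a b c d rule: less_induct)
  case less
  consider "m = 0" "n = 1" | "n = 0" "m = 1" | "m > 0" "n > 0" "n \<le> m" | "m > 0" "n > 0" "m \<le> n"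
    using less.prems(2) by (cases "m = 0"; cases "n = 0"; fastforce)
  then show ?case
  proof cases
    case 1 then show ?thesis using assms(4)[OF less.prems(1)] by simp
  next
    case 2 then show ?thesis using assms(4)[OF less.prems(1)] by simp
  next
    case 3
    have "coprime (m - n) n" using less.prems(2) 3 by (simp add: coprime_iff_gcd_eq_1 gcd_diff1_nat)
    then have "P (int (m - n) * a + int n * (a + c)) (int (m - n) * b + int n * (b + d))"
      using 3 assms(3)[OF less.prems(1)] by (intro less.hyps) auto
    then show ?thesis using 3 by (simp add: of_nat_diff algebra_simps)
  next
    case 4
    have "coprime m (n - m)" using less.prems(2) 4
      by (metis coprime_iff_gcd_eq_1 gcd_diff1_nat gcd.commute)
    then have "P (int m * (a + c) + int (n - m) * c) (int m * (b + d) + int (n - m) * d)"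
      using 4 assms(3)[OF less.prems(1)] by (intro less.hyps) auto
    then show ?thesis using 4 by (simp add: of_nat_diff algebra_simps)
  qed
qed

text \<open>The neighbours of the region of v = (a, b) are w + k v with w = (c, d). The cones
  spanned by consecutive neighbours tile the half plane where the coefficient of w is
  positive.\<close>

lemma slope_in_strip:
  fixes a b c d :: int
  assumes D: "a * d - b * c = 1"
  obtains "s = slope_of a b"
  | k m n where "coprime m n"
     "s = slope_of (int m * (c + k * a) + int n * (c + (k + 1) * a))
                   (int m * (d + k * b) + int n * (d + (k + 1) * b))"
proof -
  obtain p q where s: "coprime p q" "s = slope_of p q" by (rule slope_obtain)
  have "\<exists>x y. p = x * a + y * c \<and> q = x * b + y * d"
  proof (intro exI conjI)
    have "p = p * (a * d - b * c)" using D by simp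
    then show "p = (p * d - q * c) * a + (a * q - b * p) * c" by (simp add: algebra_simps)
    have "q = q * (a * d - b * c)" using D by simp
    then show "q = (p * d - q * c) * b + (a * q - b * p) * d" by (simp add: algebra_simps)
  qed
  then obtain x0 y0 where xy0: "p = x0 * a + y0 * c" "q = x0 * b + y0 * d" by blast
  define x where "x = (if y0 < 0 then - x0 else x0)"
  define y where "y = \<bar>y0\<bar>"
  have s': "s = slope_of (x * a + y * c) (x * b + y * d)"
    using slope_of_minus[of p q] s(2) xy0 by (auto simp: x_def y_def abs_if algebra_simps)
  have cop: "coprime x y"
  proof (rule coprimeI)
    fix e assume "e dvd x" "e dvd y"
    then have "e dvd x0" "e dvd y0" by (auto simp: x_def y_def split: if_splits)
    then have "e dvd p" "e dvd q" using xy0 by auto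
    then show "is_unit e" using s(1) by (rule coprime_common_divisor[rotated])
  qed
  show thesis
  proof (cases "y = 0")
    case True
    then have "\<bar>x\<bar> = 1" using cop by simp
    then have "x = 1 \<or> x = -1" by linarith
    then show ?thesis using that(1) s' True slope_of_minus[of a b] by auto
  next
    case False
    then have y: "y > 0" by (simp add: y_def)
    \<comment> \<open>With x = k y + r, one has x v + y w = (y - r) (w + k v) + r (w + (k + 1)
      v).\<close>
    define r where "r = x mod y"
    have r: "0 \<le> r" "r < y" using y by (auto simp: r_def)
    have xr: "x = (x div y) * y + r" by (simp add: r_def)
    have "gcd r (y - r) = gcd y x"
      unfolding r_def by (metis gcd.commute gcd_diff1 gcd_red_int)
    then have "coprime r (y - r)" using cop by (simp add: coprime_iff_gcd_eq_1 gcd.commute)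
    then have c: "coprime (nat (y - r)) (nat r)"
      using r by (simp add: coprime_int_iff[symmetric] coprime_commute)
    have "s = slope_of (int (nat (y - r)) * (c + (x div y) * a) + int (nat r) * (c + (x div y + 1) * a))
                   (int (nat (y - r)) * (d + (x div y) * b) + int (nat r) * (d + (x div y + 1) * b))"
      using r unfolding s' by (subst (1 2) xr) (simp add: algebra_simps)
    then show ?thesis using that(2)[OF c] by blast
  qed
qed

section \<open>Markoff maps with prescribed values\<close>

lemma slope_triple_induct:
  assumes base: "P Infty" "P (int_slope 0)" "P (int_slope 1)"
    and step: "\<And>a b c d. \<lbrakk>\<bar>a * d - b * c\<bar> = 1; P (slope_of a b); P (slope_of c d);
      P (slope_of (a - c) (b - d))\<rbrakk> \<Longrightarrow> P (slope_of (a + c) (b + d))"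
  shows "P s"
proof -
  have Z: "P (slope_of k 1) \<and> P (slope_of (k + 1) 1)" for k
  proof (induction k rule: int_induct[where k = 0])
    case base
    then show ?case using assms(2,3) by (simp add: int_slope_eq)
  next
    case (step1 i)
    have "P (slope_of ((i + 1) + 1) (1 + 0))"
      using step1 base(1) by (intro step) (auto simp: Infty_eq)
    then show ?case using step1 by simp
  next
    case (step2 i)
    \<comment> \<open>The vector (-1, 0) represents \<open>Infty\<close> as well; adding it moves to
      the left.\<close>
    have "P (slope_of (i + (- 1)) (1 + 0))"
      using step2 base(1) slope_of_minus[of 1 0] by (intro step) (auto simp: Infty_eq)
    then show ?case using step2 by simp
  qed
  define Q where "Q a b c d \<longleftrightarrow> \<bar>a * d - b * c\<bar> = 1 \<and> P (slope_of a b) \<and> P (slope_of c d) \<and>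
      P (slope_of (a - c) (b - d))" for a b c d
  have Q: "Q a b (a + c) (b + d) \<and> Q (a + c) (b + d) c d" if "Q a b c d" for a b c d
  proof -
    have D: "a * (b + d) - b * (a + c) = a * d - b * c" "(a + c) * d - (b + d) * c = a * d - b * c"
      by algebra+
    have "P (slope_of (a + c) (b + d))" using step that unfolding Q_def by blast
    \<comment> \<open>The difference of v and v + w is - w, which has the region of w.\<close>
    then show ?thesis using that slope_of_minus[of c d] unfolding Q_def D by simp
  qed
  show ?thesis
  proof (rule slope_in_strip[of 1 1 0 0 s])
    assume "s = slope_of 1 0"
    then show "P s" using base by (simp add: Infty_eq)
  next
    fix k and m n :: nat
    assume mn: "coprime m n" and s: "s = slope_of (int m * (0 + k * 1) + int n * (0 + (k + 1) * 1))
      (int m * (1 + k * 0) + int n * (1 + (k + 1) * 0))"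
    have "Q (0 + k * 1) (1 + k * 0) (0 + (k + 1) * 1) (1 + (k + 1) * 0)"
      using Z[of k] base(1) slope_of_minus[of 1 0] by (simp add: Q_def Infty_eq)
    from this mn show "P s" unfolding s
      by (rule cone_induct[where P = "\<lambda>p q. P (slope_of p q)"]) (use Q in \<open>auto simp: Q_def\<close>)
  qed simp
qed

text \<open>The value at \<open>p / q\<close> of the Markoff map with values \<open>x, y, z\<close> at \<open>1 / 0\<close>, \<open>0 / 1\<close>, \<open>1 / 1\<close>;
  each step expresses \<open>(p, q)\<close> in a new basis of \<open>\<int>\<^sup>2\<close>. The coefficient ring is arbitrary
  because a deformation is the linear coefficient of a Markoff map with polynomial values.\<close>

fun markoff_value :: "nat \<Rightarrow> nat \<Rightarrow> 'a \<Rightarrow> 'a \<Rightarrow> 'a \<Rightarrow> 'a::comm_ring_1" where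
  "markoff_value p q x y z =
     (if p = 0 then y else if q = 0 then x
      else if q \<le> p then markoff_value (p - q) q x z (x * z - y)
      else markoff_value p (q - p) z y (z * y - x))"

declare markoff_value.simps [simp del]

lemma markoff_value_0 [simp]:
  "markoff_value 0 q x y z = y" "0 < p \<Longrightarrow> markoff_value p 0 x y z = x"
  by (simp_all add: markoff_value.simps)

lemma markoff_value_ge:
  "q \<le> p \<Longrightarrow> 0 < p \<Longrightarrow> markoff_value p q x y z = markoff_value (p - q) q x z (x * z - y)"
  by (subst markoff_value.simps) auto

text \<open>At p = q the recursion takes the other branch, but both branches end in z. Hence ties
  may be sent either way in the case distinctions below.\<close>

lemma markoff_value_le:
  "p \<le> q \<Longrightarrow> 0 < q \<Longrightarrow> markoff_value p q x y z = markoff_value p (q - p) z y (z * y - x)"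
  by (cases "p = q"; cases "p = 0"; subst markoff_value.simps) auto

text \<open>This is the relation for v = (c + e, d + f) and w = (c, d), with v - w = (e, f), written
  without subtraction. If (c, d) and (e, f) lie on the same side of the diagonal, one Euclidean step
  acts on all four vectors at once; otherwise they are the two unit vectors.\<close>

lemma markoff_value_rel:
  assumes "\<bar>int c * int f - int d * int e\<bar> = 1"
  shows "markoff_value (2 * c + e) (2 * d + f) x y z + markoff_value e f x y z =
    markoff_value (c + e) (d + f) x y z * markoff_value c d x y z"
  using assms
proof (induction "c + d + e + f" arbitrary: c d e f x y z rule: less_induct)
  case less
  have D: "int c * int f - int d * int e = 1 \<or> int c * int f - int d * int e = -1"
    using less.prems by linarith
  consider "d \<le> c" "f \<le> e" | "c \<le> d" "e \<le> f" | "d < c" "e < f" | "c < d" "f < e"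
    by linarith
  then show ?case
  proof cases
    case 1
    have pos: "0 < c" "0 < e" "0 < d + f"
      using D 1 by (auto intro!: Nat.gr0I)
    have [simp]: "2 * c + e - (2 * d + f) = 2 * (c - d) + (e - f)" 
       "c + e - (d + f) = (c - d) + (e - f)" using 1 by linarith+
    have "markoff_value (2 * (c - d) + (e - f)) (2 * d + f) x z (x * z - y) +
        markoff_value (e - f) f x z (x * z - y) =
      markoff_value ((c - d) + (e - f)) (d + f) x z (x * z - y) *
        markoff_value (c - d) d x z (x * z - y)"
      using 1 pos less.prems by (intro less.hyps) (auto simp: of_nat_diff algebra_simps)
    moreover have "markoff_value p q x y z = markoff_value (p - q) q x z (x * z - y)"
      if "(p, q) \<in> {(c, d), (e, f), (c + e, d + f), (2 * c + e, 2 * d + f)}" for p q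
      using that 1 pos by (intro markoff_value_ge) auto
    ultimately show ?thesis by simp
  next
    case 2
    have pos: "0 < d" "0 < f" "0 < c + e"
      using D 2 by (auto intro!: Nat.gr0I)
    have [simp]: "2 * d + f - (2 * c + e) = 2 * (d - c) + (f - e)" 
       "d + f - (c + e) = (d - c) + (f - e)" using 2 by linarith+
    have "markoff_value (2 * c + e) (2 * (d - c) + (f - e)) z y (z * y - x) +
        markoff_value e (f - e) z y (z * y - x) =
      markoff_value (c + e) ((d - c) + (f - e)) z y (z * y - x) *
        markoff_value c (d - c) z y (z * y - x)"
      using 2 pos less.prems by (intro less.hyps) (auto simp: of_nat_diff algebra_simps)
    moreover have "markoff_value p q x y z = markoff_value p (q - p) z y (z * y - x)"
      if "(p, q) \<in> {(c, d), (e, f), (c + e, d + f), (2 * c + e, 2 * d + f)}" for p q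
      using that 2 pos by (intro markoff_value_le) auto
    ultimately show ?thesis by simp
  next
    case 3
    \<comment> \<open>Since c f is at most d e + 1, expanding the product leaves d + e <= 0.\<close>
    have "(int d + 1) * (int e + 1) \<le> int c * int f" using 3 by (intro mult_mono) auto
    then have "int d + int e \<le> 0" using D by (auto simp: algebra_simps)
    then have "d = 0" "e = 0" by auto
    moreover have "0 \<le> int c * int f" "int d * int e = 0" using \<open>d = 0\<close> by simp_all
    then have "int c * int f = 1" using D by linarith
    then have "c = 1" "f = 1" by (auto simp: zmult_eq_1_iff)
    ultimately show ?thesis by (simp add: markoff_value.simps)
  next
    case 4
    have "(int c + 1) * (int f + 1) \<le> int d * int e" using 4 by (intro mult_mono) auto
    then have "int c + int f \<le> 0" using D by (auto simp: algebra_simps)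
    then have "c = 0" "f = 0" by auto
    moreover have "0 \<le> int d * int e" "int c * int f = 0" using \<open>c = 0\<close> by simp_all
    then have "int d * int e = 1" using D by linarith
    then have "d = 1" "e = 1" by (auto simp: zmult_eq_1_iff)
    ultimately show ?thesis by (simp add: markoff_value.simps)
  qed
qed

text \<open>Vectors of negative slope are reflected into the first quadrant. The relation for (1, 0)
  and (0, 1) forces the value x y - z at (1, -1), which becomes the third seed there.\<close>

definition signed_markoff_value :: "'a \<Rightarrow> 'a \<Rightarrow> 'a \<Rightarrow> int \<Rightarrow> int \<Rightarrow> 'a::comm_ring_1" where
  "signed_markoff_value x y z p q =
     markoff_value (nat \<bar>p\<bar>) (nat \<bar>q\<bar>) x y (if 0 \<le> p * q then z else x * y - z)"

lemma signed_markoff_value_minus [simp]: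
  "signed_markoff_value x y z (- p) (- q) = signed_markoff_value x y z p q"
  by (simp add: signed_markoff_value_def)

lemma signed_markoff_value_of_nat:
  "signed_markoff_value x y z (int p) (int q) = markoff_value p q x y z"
  by (simp add: signed_markoff_value_def)

lemma signed_markoff_value_reflect:
  "signed_markoff_value x y z p (- q) = signed_markoff_value x y (x * y - z) p q"
proof (cases "p * q = 0")
  case True
  then show ?thesis by (cases "p = 0") (auto simp: signed_markoff_value_def)
next
  case False
  then show ?thesis by (auto simp: signed_markoff_value_def)
qed

text \<open>Up to sign v - w stays in the quadrant, except when v and w are the unit vectors; then
  the relation is the choice of the reflected seed.\<close>

lemma signed_markoff_value_rel_nonneg:
  assumes D: "\<bar>a * d - b * c\<bar> = 1" and nn: "0 \<le> a" "0 \<le> b" "0 \<le> c" "0 \<le> d"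
  shows "signed_markoff_value x y z (a - c) (b - d) + signed_markoff_value x y z (a + c) (b + d) =
    signed_markoff_value x y z a b * signed_markoff_value x y z c d"
proof -
  have *: "signed_markoff_value x y z (a - c) (b - d) + signed_markoff_value x y z (a + c) (b + d) =
      signed_markoff_value x y z a b * signed_markoff_value x y z c d"
    if D: "\<bar>a * d - b * c\<bar> = 1" and "0 \<le> c" "c \<le> a" "0 \<le> d" "d \<le> b" for a b c d :: int
  proof -
    define C D' E F where "C = nat c" and "D' = nat d" and "E = nat (a - c)" and "F = nat (b - d)"
    have eq: "a - c = int E" "b - d = int F" "a + c = int (2 * C + E)" "b + d = int (2 * D' + F)"
        "a = int (C + E)" "b = int (D' + F)" "c = int C" "d = int D'"
      using that by (auto simp: C_def D'_def E_def F_def)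
    have "a * d - b * c = (a - c) * d - (b - d) * c" by algebra
    also have "\<dots> = - (int C * int F - int D' * int E)" using eq(1,2,7,8) by simp
    finally have "\<bar>int C * int F - int D' * int E\<bar> = 1" using D by simp
    from markoff_value_rel[OF this, of x y z] show ?thesis
      unfolding eq(1-4) unfolding eq(5-8) signed_markoff_value_of_nat by (simp only: add.commute)
  qed
  consider "c \<le> a" "d \<le> b" | "a \<le> c" "b \<le> d" | "c < a" "b < d" | "a < c" "d < b" by linarith
  then show ?thesis
  proof cases
    case 1 then show ?thesis using * D nn by blast
  next
    case 2
    have "\<bar>c * b - d * a\<bar> = 1" using D by (simp add: abs_minus_commute mult.commute)
    from *[OF this] show ?thesis
      using 2 nn signed_markoff_value_minus[of x y z "c - a" "d - b"]
      by (simp add: add.commute mult.commute)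
  next
    case 3
    have "(c + 1) * (b + 1) \<le> a * d" using 3 nn by (intro mult_mono) auto
    then have "b + c \<le> 0" using D by (auto simp: algebra_simps)
    then have "b = 0" "c = 0" using nn by auto
    moreover from this D nn have "a * d = 1" by (simp add: abs_mult)
    then have "a = 1" "d = 1" using nn by (auto simp: zmult_eq_1_iff)
    ultimately show ?thesis by (simp add: signed_markoff_value_def markoff_value.simps)
  next
    case 4
    have "(a + 1) * (d + 1) \<le> c * b" using 4 nn by (intro mult_mono) auto
    then have "a + d \<le> 0" using D by (auto simp: algebra_simps)
    then have "a = 0" "d = 0" using nn by auto
    moreover from this D nn have "b * c = 1" by (simp add: abs_mult)
    then have "b = 1" "c = 1" using nn by (auto simp: zmult_eq_1_iff)
    ultimately show ?thesis by (simp add: signed_markoff_value_def markoff_value.simps mult.commute)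
  qed
qed

lemma signed_markoff_value_rel_same_sign:
  assumes D: "\<bar>a * d - b * c\<bar> = 1" and nn: "0 \<le> a * b" "0 \<le> c * d"
  shows "signed_markoff_value x y z (a - c) (b - d) + signed_markoff_value x y z (a + c) (b + d) =
    signed_markoff_value x y z a b * signed_markoff_value x y z c d"
proof -
  note R = signed_markoff_value_rel_nonneg[of _ _ _ _ x y z]
  note M = signed_markoff_value_minus[of x y z]
  consider "0 \<le> a" "0 \<le> b" "0 \<le> c" "0 \<le> d" | "a \<le> 0" "b \<le> 0" "0 \<le> c" "0 \<le> d"
    | "0 \<le> a" "0 \<le> b" "c \<le> 0" "d \<le> 0" | "a \<le> 0" "b \<le> 0" "c \<le> 0" "d \<le> 0"
    using nn by (auto simp: zero_le_mult_iff)
  then show ?thesis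
  proof cases
    case 1 then show ?thesis using R D by blast
  next
    case 2
    have "\<bar>- a * d - - b * c\<bar> = 1" using D by (simp add: abs_minus_commute)
    from R[OF this] 2 M[of "a + c" "b + d"] M[of "a - c" "b - d"]
    show ?thesis by (simp add: algebra_simps)
  next
    case 3
    have "\<bar>a * - d - b * - c\<bar> = 1" using D by (simp add: abs_minus_commute)
    from R[OF this] 3 show ?thesis by (simp add: algebra_simps)
  next
    case 4
    have "\<bar>- a * - d - - b * - c\<bar> = 1" using D by simp
    from R[OF this] 4 M[of "a + c" "b + d"] M[of "a - c" "b - d"]
    show ?thesis by (simp add: algebra_simps)
  qed
qed

lemma signed_markoff_value_rel:
  assumes D: "\<bar>a * d - b * c\<bar> = 1"
  shows "signed_markoff_value x y z (a - c) (b - d) + signed_markoff_value x y z (a + c) (b + d) =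
    signed_markoff_value x y z a b * signed_markoff_value x y z c d"
proof -
  \<comment> \<open>For vectors inside adjacent quadrants, a d and b c are nonzero of opposite
    signs, so the determinant is at least 2 in absolute value. Hence a single reflection brings a
    basis to the previous case.\<close>
  have not: False if "0 < a * b * - (c * d)"
  proof -
    have "a * d * (b * c) < 0" using that by (simp add: mult_ac)
    then consider "0 < a * d" "b * c < 0" | "a * d < 0" "0 < b * c" by (auto simp: mult_less_0_iff)
    then show False using D by cases linarith+
  qed
  then consider "0 \<le> a * b" "0 \<le> c * d" | "a * b \<le> 0" "c * d \<le> 0"
    by (metis linorder_not_less mult_pos_pos neg_0_less_iff_less mult_neg_neg neg_less_0_iff_less order_le_less)
  then show ?thesis
  proof cases
    case 1 then show ?thesis using signed_markoff_value_rel_same_sign D by blast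
  next
    case 2
    have "\<bar>a * - d - - b * c\<bar> = 1" using D by (simp add: abs_minus_commute)
    from signed_markoff_value_rel_same_sign[OF this, of x y "x * y - z"] 2
      signed_markoff_value_reflect[of x y z _ "- _"]
    have "signed_markoff_value x y (x * y - z) (a - c) (- (b - d)) +
        signed_markoff_value x y (x * y - z) (a + c) (- (b + d)) =
        signed_markoff_value x y (x * y - z) a (- b) * signed_markoff_value x y (x * y - z) c (- d)"
      by (simp add: algebra_simps)
    then show ?thesis by (simp only: signed_markoff_value_reflect) simp
  qed
qed

lemma ex_markoff_map:
  fixes x y z :: "'a::comm_ring_1"
  obtains M :: "slope \<Rightarrow> 'a" where "M Infty = x" "M (int_slope 0) = y" "M (int_slope 1) = z"
    "\<And>a b c d. \<bar>a * d - b * c\<bar> = 1 \<Longrightarrow>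
       M (slope_of (a - c) (b - d)) + M (slope_of (a + c) (b + d)) = M (slope_of a b) * M (slope_of c d)"
proof -
  define M where "M s = signed_markoff_value x y z (slope_num s) (slope_den s)" for s
  have M: "M (slope_of p q) = signed_markoff_value x y z p q" if "coprime p q" for p q
    using num_den_slope_of[OF that] by (auto simp: M_def)
  show thesis
  proof (rule that[of M])
    show "M Infty = x" "M (int_slope 0) = y" "M (int_slope 1) = z"
      unfolding Infty_eq int_slope_eq
      by (simp_all add: M signed_markoff_value_def markoff_value.simps)
    fix a b c d :: int assume D: "\<bar>a * d - b * c\<bar> = 1"
    show "M (slope_of (a - c) (b - d)) + M (slope_of (a + c) (b + d)) = M (slope_of a b) * M (slope_of c d)"
      by (simp add: M coprime_if_det[OF D] signed_markoff_value_rel[OF D])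
  qed
qed

section \<open>Deformations with prescribed coordinates: uniqueness and existence\<close>

lemma inf_deformation_unique:
  assumes "inf_deformation \<Phi> \<phi>" "inf_deformation \<Phi> \<psi>"
    "\<phi> Infty = \<psi> Infty" "\<phi> (int_slope 0) = \<psi> (int_slope 0)" "\<phi> (int_slope 1) = \<psi> (int_slope 1)"
  shows "\<phi> = \<psi>"
proof
  fix s show "\<phi> s = \<psi> s"
  proof (rule slope_triple_induct[of "\<lambda>s. \<phi> s = \<psi> s"])
    fix a b c d assume "\<bar>a * d - b * c\<bar> = 1" "\<phi> (slope_of a b) = \<psi> (slope_of a b)"
      "\<phi> (slope_of c d) = \<psi> (slope_of c d)"
      "\<phi> (slope_of (a - c) (b - d)) = \<psi> (slope_of (a - c) (b - d))"
    then show "\<phi> (slope_of (a + c) (b + d)) = \<psi> (slope_of (a + c) (b + d))"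
      using assms(1,2) unfolding inf_deformation_iff by (metis add_left_cancel)
  qed (use assms in auto)
qed

text \<open>The linear coefficient of a product obeys the product rule, which is the linearized
  relation once the constant coefficients are known to be \<Phi>; they are, because a Markoff map is
  determined by three values.\<close>

lemma ex_inf_deformation:
  assumes "markoff_map \<Phi>"
  obtains \<phi> where "inf_deformation \<Phi> \<phi>" "\<phi> Infty = X" "\<phi> (int_slope 0) = Y" "\<phi> (int_slope 1) = Z"
proof -
  obtain M :: "slope \<Rightarrow> real poly" where M: "M Infty = [:\<Phi> Infty, X:]"
      "M (int_slope 0) = [:\<Phi> (int_slope 0), Y:]" "M (int_slope 1) = [:\<Phi> (int_slope 1), Z:]"
    and rel: "\<And>a b c d. \<bar>a * d - b * c\<bar> = 1 \<Longrightarrow>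
       M (slope_of (a - c) (b - d)) + M (slope_of (a + c) (b + d)) = M (slope_of a b) * M (slope_of c d)"
    by (rule ex_markoff_map[of "[:\<Phi> Infty, X:]" "[:\<Phi> (int_slope 0), Y:]"
          "[:\<Phi> (int_slope 1), Z:]"]) blast
  have 0: "coeff (M s) 0 = \<Phi> s" for s
  proof (rule slope_triple_induct[of "\<lambda>s. coeff (M s) 0 = \<Phi> s"])
    fix a b c d assume D: "\<bar>a * d - b * c\<bar> = 1" and eq: "coeff (M (slope_of a b)) 0 = \<Phi> (slope_of a b)"
      "coeff (M (slope_of c d)) 0 = \<Phi> (slope_of c d)"
      "coeff (M (slope_of (a - c) (b - d))) 0 = \<Phi> (slope_of (a - c) (b - d))"
    have "\<Phi> (slope_of (a - c) (b - d)) + \<Phi> (slope_of (a + c) (b + d)) =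
        \<Phi> (slope_of a b) * \<Phi> (slope_of c d)"
      using assms D unfolding markoff_map_iff by blast
    moreover have "coeff (M (slope_of (a - c) (b - d))) 0 + coeff (M (slope_of (a + c) (b + d))) 0 =
        coeff (M (slope_of a b)) 0 * coeff (M (slope_of c d)) 0"
      by (simp add: rel[OF D] coeff_mult flip: coeff_add)
    ultimately show "coeff (M (slope_of (a + c) (b + d))) 0 = \<Phi> (slope_of (a + c) (b + d))"
      using eq by simp
  qed (use M in auto)
  show thesis
  proof (rule that[of "\<lambda>s. coeff (M s) 1"])
    show "inf_deformation \<Phi> (\<lambda>s. coeff (M s) 1)"
      unfolding inf_deformation_iff
      by (auto simp: rel coeff_mult 0 algebra_simps simp flip: coeff_add)
  qed (use M in auto)
qed

section \<open>Positive deformations\<close>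

lemma proj_eq_iff:
  assumes "v \<noteq> 0" "w \<noteq> 0"
  shows "proj v = proj w \<longleftrightarrow> (\<exists>c. c \<noteq> 0 \<and> w = c *\<^sub>R v)"
proof -
  have "span {x} \<in> {L. subspace L \<and> dim L = 1}" if "x \<noteq> 0" for x :: "real^3"
    using that by (simp add: dim_eq_card_independent)
  then have "proj v = proj w \<longleftrightarrow> span {v} = span {w}"
    using assms by (simp add: proj_def Abs_rp2_inject)
  also have "\<dots> \<longleftrightarrow> (\<exists>c. c \<noteq> 0 \<and> w = c *\<^sub>R v)"
  proof
    assume "span {v} = span {w}"
    then have "w \<in> span {v}" by (simp add: span_base)
    then show "\<exists>c. c \<noteq> 0 \<and> w = c *\<^sub>R v" using assms by (auto simp: span_singleton)
  next
    assume "\<exists>c. c \<noteq> 0 \<and> w = c *\<^sub>R v"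
    then obtain c where c: "c \<noteq> 0" "w = c *\<^sub>R v" by blast
    have "k *\<^sub>R v \<in> range (\<lambda>k. k *\<^sub>R w)" for k
      by (rule range_eqI[of _ _ "k / c"]) (use c in simp)
    moreover have "k *\<^sub>R w \<in> range (\<lambda>k. k *\<^sub>R v)" for k
      by (rule range_eqI[of _ _ "k * c"]) (use c in simp)
    ultimately show "span {v} = span {w}" unfolding span_singleton by blast
  qed
  finally show ?thesis .
qed

lemma proj_scaleR: "c \<noteq> 0 \<Longrightarrow> v \<noteq> 0 \<Longrightarrow> proj (c *\<^sub>R v) = proj v"
  using proj_eq_iff[of v "c *\<^sub>R v"] by auto

lemma Rep_proj: "v \<noteq> 0 \<Longrightarrow> Rep_rp2 (proj v) = span {v}"
  unfolding proj_def by (rule Abs_rp2_inverse) (simp add: dim_eq_card_independent)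

lemma rp2_obtain:
  obtains v where "v \<noteq> 0" "x = proj v"
proof -
  have "subspace (Rep_rp2 x)" "dim (Rep_rp2 x) = 1" using Rep_rp2[of x] by auto
  then obtain B where B: "B \<subseteq> Rep_rp2 x" "independent B" "Rep_rp2 x \<subseteq> span B" "card B = 1"
    using basis_exists by metis
  then obtain v where v: "B = {v}" by (auto simp: card_1_singleton_iff)
  have "Rep_rp2 x = span {v}"
    using B v \<open>subspace (Rep_rp2 x)\<close> by (metis span_minimal subset_antisym)
  then have "x = proj v" unfolding proj_def by (metis Rep_rp2_inverse)
  moreover have "v \<noteq> 0" using B v by auto
  ultimately show thesis using that by blast
qed

lemma inf_deformation_lincomb:
  assumes "inf_deformation \<Phi> \<phi>" "inf_deformation \<Phi> \<psi>"
  shows "inf_deformation \<Phi> (\<lambda>s. a * \<phi> s + b * \<psi> s)"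
  unfolding inf_deformation_def
proof (intro allI impI)
  fix R R' R'' R''' assume "adjacent_except_ends R R' R'' R'''"
  then have "\<phi> R + \<phi> R''' = \<phi> R' * \<Phi> R'' + \<Phi> R' * \<phi> R''"
    "\<psi> R + \<psi> R''' = \<psi> R' * \<Phi> R'' + \<Phi> R' * \<psi> R''"
    using assms unfolding inf_deformation_def by blast+
  then show "a * \<phi> R + b * \<psi> R + (a * \<phi> R''' + b * \<psi> R''') =
     (a * \<phi> R' + b * \<psi> R') * \<Phi> R'' + \<Phi> R' * (a * \<phi> R'' + b * \<psi> R'')"
    by algebra
qed

lemma deform_coords_nth [simp]:
  "deform_coords \<phi> $ 1 = \<phi> Infty" "deform_coords \<phi> $ 2 = \<phi> (int_slope 0)"
  "deform_coords \<phi> $ 3 = \<phi> (int_slope 1)"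
  by (simp_all add: deform_coords_def)

lemma vec3_eq_iff: "(v :: real^3) = w \<longleftrightarrow> v $ 1 = w $ 1 \<and> v $ 2 = w $ 2 \<and> v $ 3 = w $ 3"
  by (simp add: vec_eq_iff forall_3)

text \<open>The value 2 at \<open>Infty\<close> makes n \<mapsto> \<Phi>(n) an affine sequence, and
  a nonconstant one becomes negative at one end.\<close>

lemma markoff_map_int_slopes_eq:
  assumes "markoff_map \<Phi>" "\<forall>s. 2 \<le> \<Phi> s" "\<Phi> Infty = 2"
  shows "\<Phi> (int_slope n) = \<Phi> (int_slope 0)"
proof -
  define g where "g k = \<Phi> (int_slope k)" for k
  have rec: "g (k - 1) + g (k + 1) = 2 * g k" for k
    using assms(1)[unfolded markoff_map_iff, rule_format, of k 0 1 1] assms(3)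
    by (simp add: g_def int_slope_eq Infty_eq)
  define \<delta> where "\<delta> = g 1 - g 0"
  have *: "g k = g 0 + of_int k * \<delta> \<and> g (k + 1) = g k + \<delta>" for k
  proof (induction k rule: int_induct[where k = 0])
    case base
    then show ?case by (simp add: \<delta>_def)
  next
    case (step1 i)
    then show ?case using rec[of "i + 1"] by (simp add: algebra_simps)
  next
    case (step2 i)
    then show ?case using rec[of i] by (simp add: algebra_simps)
  qed
  have "\<delta> = 0"
  proof (rule ccontr)
    assume "\<delta> \<noteq> 0"
    obtain k :: int where "- g 0 / \<delta> < of_int k" using ex_less_of_int by blast
    obtain j :: int where "of_int j < - g 0 / \<delta>" using ex_of_int_less by blast
    have "g 0 + of_int k * \<delta> < 0 \<or> g 0 + of_int j * \<delta> < 0"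
      using \<open>\<delta> \<noteq> 0\<close> \<open>- g 0 / \<delta> < of_int k\<close> \<open>of_int j < - g 0 / \<delta>\<close>
      by (cases "\<delta> > 0") (auto simp: field_simps)
    then have "g k < 0 \<or> g j < 0" using * by metis
    then show False using assms(2) unfolding g_def by (smt (verit))
  qed
  then show ?thesis using * unfolding g_def by simp
qed

locale cusp_markoff_map =
  fixes \<Phi> :: "slope \<Rightarrow> real" and y :: real
  assumes markoff: "markoff_map \<Phi>" and ge2: "2 \<le> \<Phi> s"
    and Infty2: "\<Phi> Infty = 2" and int2y: "\<Phi> (int_slope n) = 2 * y" and y_gt1: "1 < y"
begin

text \<open>If y = cosh t with t > 0, this is sinh t, and \<open>lam\<close> below is e^t, the
  larger root of X^2 - 2 y X + 1.\<close>

definition sh :: real where "sh = sqrt (y\<^sup>2 - 1)"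

lemma sh_square: "sh\<^sup>2 = y\<^sup>2 - 1"
  using y_gt1 by (simp add: sh_def)

lemma sh_pos: "0 < sh"
  using y_gt1 by (simp add: sh_def)

definition lam :: real where "lam = y + sh"

lemma lam_gt1: "1 < lam"
  using y_gt1 sh_pos by (simp add: lam_def)

lemma inverse_lam: "inverse lam = y - sh"
proof -
  have "lam * (y - sh) = 1" using sh_square by (simp add: lam_def algebra_simps power2_eq_square)
  then show ?thesis by (simp add: inverse_unique)
qed

text \<open>The inverse of \<open>deform_coords\<close>: deformations are treated as vectors of R^3,
  and evaluation at a region becomes a linear form.\<close>

definition deformation_of :: "real ^ 3 \<Rightarrow> slope \<Rightarrow> real" where
  "deformation_of v = (SOME \<phi>. inf_deformation \<Phi> \<phi> \<and> deform_coords \<phi> = v)"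

lemma deformation_of:
  "inf_deformation \<Phi> (deformation_of v)" "deform_coords (deformation_of v) = v"
proof -
  obtain \<phi> where "inf_deformation \<Phi> \<phi>" "\<phi> Infty = v $ 1" "\<phi> (int_slope 0) = v $ 2"
      "\<phi> (int_slope 1) = v $ 3"
    using ex_inf_deformation[OF markoff] by metis
  then have "\<exists>\<phi>. inf_deformation \<Phi> \<phi> \<and> deform_coords \<phi> = v"
    by (intro exI[of _ \<phi>]) (simp add: vec3_eq_iff)
  then have "inf_deformation \<Phi> (deformation_of v) \<and> deform_coords (deformation_of v) = v"
    unfolding deformation_of_def by (rule someI_ex)
  then show "inf_deformation \<Phi> (deformation_of v)" "deform_coords (deformation_of v) = v" by auto
qed

lemma deformation_of_coords: "inf_deformation \<Phi> \<phi> \<Longrightarrow> deformation_of (deform_coords \<phi>) = \<phi>"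
  using inf_deformation_unique[OF deformation_of(1)] deformation_of(2)[of "deform_coords \<phi>"]
  by (metis deform_coords_nth)

lemma deformation_of_base [simp]:
  "deformation_of v Infty = v $ 1" "deformation_of v (int_slope 0) = v $ 2"
  "deformation_of v (int_slope 1) = v $ 3"
  using deformation_of(2)[of v] by (metis deform_coords_nth)+

lemma deformation_of_lincomb:
  "deformation_of (a *\<^sub>R v + b *\<^sub>R w) s = a * deformation_of v s + b * deformation_of w s"
proof -
  have "deform_coords (\<lambda>s. a * deformation_of v s + b * deformation_of w s) = a *\<^sub>R v + b *\<^sub>R w"
    by (simp add: vec3_eq_iff)
  then show ?thesis
    using deformation_of_coords[OF inf_deformation_lincomb[OF deformation_of(1) deformation_of(1)],
      of a v b w] by simp
qed

lemma deformation_of_scaleR: "deformation_of (a *\<^sub>R v) s = a * deformation_of v s"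
  using deformation_of_lincomb[of a v 0 v] by simp

lemma continuous_deformation_of: "continuous_on A (\<lambda>v. deformation_of v s)"
proof -
  have "linear (\<lambda>v. deformation_of v s)"
    using deformation_of_lincomb[of 1 _ 1] deformation_of_scaleR by (intro linearI) auto
  then show ?thesis by (simp add: linear_continuous_on linear_conv_bounded_linear)
qed

lemma deformation_rel:
  assumes "inf_deformation \<Phi> \<phi>" "\<bar>a * d - b * c\<bar> = 1"
  shows "\<phi> (slope_of (a - c) (b - d)) + \<phi> (slope_of (a + c) (b + d)) =
     \<phi> (slope_of a b) * \<Phi> (slope_of c d) + \<Phi> (slope_of a b) * \<phi> (slope_of c d)"
  using assms unfolding inf_deformation_iff by blast

text \<open>Because \<Phi> is 2 at \<open>Infty\<close>, the relation around this region prescribes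
  the constant second difference 2 y \<phi>(R).\<close>

lemma deformation_of_int:
  "deformation_of v (int_slope n) =
     y * v $ 1 * (of_int n)\<^sup>2 + (v $ 3 - v $ 2 - y * v $ 1) * of_int n + v $ 2"
proof -
  define g where "g k = deformation_of v (int_slope k)" for k
  define h where "h k = y * v $ 1 * (of_int k)\<^sup>2 + (v $ 3 - v $ 2 - y * v $ 1) * of_int k + v $ 2"
    for k :: int
  have rec: "g (k - 1) + g (k + 1) = 2 * g k + 2 * y * v $ 1" for k
    using deformation_rel[OF deformation_of(1), of k 0 1 1 v] Infty2 int2y[of k]
    by (simp add: g_def int_slope_eq Infty_eq[symmetric])
  have rech: "h (k - 1) + h (k + 1) = 2 * h k + 2 * y * v $ 1" for k
    by (simp add: h_def power2_eq_square algebra_simps)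
  have "g k = h k \<and> g (k + 1) = h (k + 1)" for k
  proof (induction k rule: int_induct[where k = 0])
    case base
    then show ?case by (simp add: g_def h_def)
  next
    case (step1 i)
    then show ?case using rec[of "i + 1"] rech[of "i + 1"] by simp
  next
    case (step2 i)
    then show ?case using rec[of i] rech[of i] by simp
  qed
  then show ?thesis by (simp add: g_def h_def)
qed

text \<open>Since \<open>\<Phi> \<ge> 2\<close>, the inequality \<open>\<phi>(v) + \<phi>(w) \<le> \<phi>(v + w)\<close> propagates outwards in the tree,
  away from the region on which \<open>\<phi>\<close> vanishes.\<close>

lemma deformation_ge:
  assumes \<phi>: "inf_deformation \<Phi> \<phi>" and D: "a * d - b * c = 1" and "0 \<le> e"
    and zero: "\<phi> (slope_of a b) = 0"
    and nbrs: "\<And>k. e \<le> \<phi> (slope_of (c + k * a) (d + k * b))"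
    and "s \<noteq> slope_of a b"
  shows "e \<le> \<phi> s"
proof -
  define Q where "Q a b c d \<longleftrightarrow> \<bar>a * d - b * c\<bar> = 1 \<and> e \<le> \<phi> (slope_of a b) \<and>
      e \<le> \<phi> (slope_of c d) \<and> \<phi> (slope_of a b) + \<phi> (slope_of c d) \<le> \<phi> (slope_of (a + c) (b + d))"
    for a b c d
  have mult2: "2 * \<phi> s + 2 * \<phi> t \<le> \<phi> s * \<Phi> t + \<Phi> s * \<phi> t" if "e \<le> \<phi> s" "e \<le> \<phi> t" for s t
    using mult_left_mono[OF ge2[of t], of "\<phi> s"] mult_right_mono[OF ge2[of s], of "\<phi> t"] that \<open>0 \<le> e\<close>
    by (simp add: mult.commute)
  \<comment> \<open>From \<Phi> \<ge> 2, \<phi>(2 v + w) \<ge> 2 \<phi>(v) + 2 \<phi>(v + w) -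
    \<phi>(w), where \<phi>(w) \<le> \<phi>(v + w) by superadditivity. The pair v + w, w is
    symmetric.\<close>
  have step: "Q a b (a + c) (b + d) \<and> Q (a + c) (b + d) c d" if Q: "Q a b c d" for a b c d
  proof -
    note q = Q[unfolded Q_def]
    have e: "e \<le> \<phi> (slope_of (a + c) (b + d))" using q \<open>0 \<le> e\<close> by linarith
    have dt: "a * (b + d) - b * (a + c) = a * d - b * c" "(a + c) * d - (b + d) * c = a * d - b * c"
      by algebra+
    have "\<phi> (slope_of c d) + \<phi> (slope_of (a + (a + c)) (b + (b + d))) =
      \<phi> (slope_of a b) * \<Phi> (slope_of (a + c) (b + d)) + \<Phi> (slope_of a b) * \<phi> (slope_of (a + c) (b + d))"
      using deformation_rel[OF \<phi>, of a "b + d" b "a + c"] q slope_of_minus[of c d] by (simp add: dt)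
    then have 1: "\<phi> (slope_of a b) + \<phi> (slope_of (a + c) (b + d)) \<le>
        \<phi> (slope_of (a + (a + c)) (b + (b + d)))"
      using mult2[of "slope_of a b" "slope_of (a + c) (b + d)"] q e \<open>0 \<le> e\<close> by linarith
    have "\<phi> (slope_of a b) + \<phi> (slope_of (a + c + c) (b + d + d)) =
      \<phi> (slope_of (a + c) (b + d)) * \<Phi> (slope_of c d) + \<Phi> (slope_of (a + c) (b + d)) * \<phi> (slope_of c d)"
      using deformation_rel[OF \<phi>, of "a + c" d "b + d" c] q by (simp add: dt)
    then have 2: "\<phi> (slope_of (a + c) (b + d)) + \<phi> (slope_of c d) \<le>
        \<phi> (slope_of (a + c + c) (b + d + d))"
      using mult2[of "slope_of (a + c) (b + d)" "slope_of c d"] q e \<open>0 \<le> e\<close> by linarith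
    show ?thesis unfolding Q_def dt using q e 1 2 by blast
  qed
  show ?thesis
  proof (rule slope_in_strip[OF D, of s])
    fix k and m n :: nat
    assume mn: "coprime m n"
      and s: "s = slope_of (int m * (c + k * a) + int n * (c + (k + 1) * a))
                   (int m * (d + k * b) + int n * (d + (k + 1) * b))"
    have dt: "(c + k * a) * (d + (k + 1) * b) - (d + k * b) * (c + (k + 1) * a) = - (a * d - b * c)"
      by algebra
    have df: "c + k * a - (c + (k + 1) * a) = - a" "d + k * b - (d + (k + 1) * b) = - b"
      by (simp_all add: algebra_simps)
    \<comment> \<open>Consecutive neighbours differ by (a, b) up to sign, where \<phi> vanishes, so
      the relation alone gives the initial superadditivity.\<close>
    have "\<phi> (slope_of (c + k * a) (d + k * b)) + \<phi> (slope_of (c + (k + 1) * a) (d + (k + 1) * b)) \<le>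
      \<phi> (slope_of ((c + k * a) + (c + (k + 1) * a)) ((d + k * b) + (d + (k + 1) * b)))"
      using deformation_rel[OF \<phi>, of "c + k * a" "d + (k + 1) * b" "d + k * b" "c + (k + 1) * a"]
        mult2[OF nbrs[of k] nbrs[of "k + 1"]] nbrs[of k] nbrs[of "k + 1"] zero \<open>0 \<le> e\<close>
      unfolding dt df by (simp add: D)
    then have "Q (c + k * a) (d + k * b) (c + (k + 1) * a) (d + (k + 1) * b)"
      using nbrs unfolding Q_def dt by (simp add: D)
    from this mn show "e \<le> \<phi> s" unfolding s
      by (rule cone_induct[where P = "\<lambda>p q. e \<le> \<phi> (slope_of p q)"]) (use step in \<open>auto simp: Q_def\<close>)
  qed (use assms in auto)
qed

definition cusp_vec :: "real ^ 3" where
  "cusp_vec = vector [0, 1, 1]"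

lemma cusp_vec_nth [simp]: "cusp_vec $ 1 = 0" "cusp_vec $ 2 = 1" "cusp_vec $ 3 = 1"
  by (simp_all add: cusp_vec_def)

lemma deformation_cusp_int [simp]: "deformation_of cusp_vec (int_slope n) = 1"
  by (simp add: deformation_of_int)

text \<open>All neighbours of the zero region \<open>Infty\<close> have value 1, and values do not
  drop below this further out.\<close>

lemma deformation_cusp_ge1:
  assumes "s \<noteq> Infty"
  shows "1 \<le> deformation_of cusp_vec s"
proof (rule deformation_ge[of _ 1 1 0 0])
  show "1 \<le> deformation_of cusp_vec (slope_of (0 + k * 1) (1 + k * 0))" for k
    using deformation_cusp_int[of k] by (simp add: int_slope_eq)
qed (use assms in \<open>auto simp: deformation_of Infty_eq[symmetric]\<close>)

text \<open>The deformation \<open>edge_vec \<sigma> n\<close> with \<open>\<sigma> = \<plusminus> 1\<close> vanishes on \<open>R\<^sub>n\<close> and takes the values \<open>\<lambda>\<^sup>k\<close> resp.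
  \<open>\<lambda>\<^sup>-\<^sup>k\<close> on the successive neighbours of \<open>R\<^sub>n\<close>, where \<open>2 y = \<lambda> + \<lambda>\<^sup>-\<^sup>1\<close>.\<close>

definition edge_vec :: "real \<Rightarrow> int \<Rightarrow> real ^ 3" where
  "edge_vec \<sigma> n = vector [1, y * (of_int n)\<^sup>2 + \<sigma> * sh * of_int n,
     y * (1 - of_int n)\<^sup>2 - \<sigma> * sh * (1 - of_int n)]"

lemma edge_vec_nth [simp]: "edge_vec \<sigma> n $ 1 = 1"
  "edge_vec \<sigma> n $ 2 = y * (of_int n)\<^sup>2 + \<sigma> * sh * of_int n"
  "edge_vec \<sigma> n $ 3 = y * (1 - of_int n)\<^sup>2 - \<sigma> * sh * (1 - of_int n)"
  by (simp_all add: edge_vec_def)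

lemma deformation_edge_int:
  "deformation_of (edge_vec \<sigma> n) (int_slope k) = y * (of_int k - of_int n)\<^sup>2 - \<sigma> * sh * (of_int k - of_int n)"
  by (simp add: deformation_of_int power2_eq_square algebra_simps)

text \<open>Around R_n, where the deformation vanishes and \<Phi> is 2 y, the relation is the
  recurrence g(k - 1) + g(k + 1) = 2 y g(k) with characteristic roots \<open>lam\<close> and its
  inverse. The values at \<open>Infty\<close> (k = 0) and at n - 1 (k = 1) select a single root. The
  vector (-1, 0) is taken for \<open>Infty\<close> so that its determinant after (n, 1) is
  +1.\<close>

lemma deformation_edge_nbr:
  assumes "\<sigma> = 1 \<or> \<sigma> = - 1"
  shows "deformation_of (edge_vec \<sigma> n) (slope_of (-1 + k * n) (0 + k * 1)) =
    (if \<sigma> = 1 then lam else inverse lam) powi k"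
proof -
  define \<mu> where "\<mu> = (if \<sigma> = 1 then lam else inverse lam)"
  have \<mu>0: "\<mu> \<noteq> 0" using lam_gt1 by (simp add: \<mu>_def)
  have \<mu>: "\<mu> = y + \<sigma> * sh" using assms inverse_lam by (auto simp: \<mu>_def lam_def)
  have "\<mu> * \<mu> = 2 * y * \<mu> - 1"
    using sh_square assms by (auto simp: \<mu> power2_eq_square algebra_simps)
  then have inv: "\<mu> + inverse \<mu> = 2 * y"
    using \<mu>0 by (simp add: field_simps)
  define g where "g k = deformation_of (edge_vec \<sigma> n) (slope_of (-1 + k * n) (0 + k * 1))" for k
  have rec: "g (k - 1) + g (k + 1) = 2 * y * g k" for k
  proof -
    have "\<bar>(-1 + k * n) * 1 - (0 + k * 1) * n\<bar> = 1" by simp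
    from deformation_rel[OF deformation_of(1) this, of "edge_vec \<sigma> n"] show ?thesis
      using int2y[of n] deformation_edge_int[of \<sigma> n n]
      by (simp add: g_def int_slope_eq algebra_simps)
  qed
  have "g k = \<mu> powi k \<and> g (k + 1) = \<mu> powi (k + 1)" for k
  proof (induction k rule: int_induct[where k = 0])
    case base
    have "slope_of (n - 1) 1 = int_slope (n - 1)" "slope_of (-1) 0 = Infty"
      by (simp_all add: int_slope_eq slope_of_def)
    then show ?case using deformation_edge_int[of \<sigma> n "n - 1"] by (simp add: g_def \<mu>)
  next
    case (step1 i)
    have i: "\<mu> powi (i + 1 + 1) = \<mu> powi (i + 1) * \<mu>" "\<mu> powi (i + 1) = \<mu> powi i * \<mu>"
      using \<mu>0 power_int_add_1 by blast+
    have "g (i + 1 + 1) = 2 * y * g (i + 1) - g i" using rec[of "i + 1"] by simp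
    also have "\<dots> = \<mu> powi i * (2 * y * \<mu> - 1)" using step1 i by (simp add: algebra_simps)
    also have "\<dots> = \<mu> powi i * \<mu> * \<mu>" using \<open>\<mu> * \<mu> = 2 * y * \<mu> - 1\<close> by (simp add: mult.assoc)
    finally show ?case using step1 i by simp
  next
    case (step2 i)
    define t where "t = \<mu> powi (i - 1)"
    have i: "\<mu> powi i = t * \<mu>" "\<mu> powi (i + 1) = t * \<mu> * \<mu>"
      using \<mu>0 power_int_add_1[of \<mu> "i - 1"] power_int_add_1[of \<mu> i] by (simp_all add: t_def)
    have "g (i - 1) = 2 * y * g i - g (i + 1)" using rec[of i] by simp
    also have "\<dots> = t * (2 * y * \<mu> - \<mu> * \<mu>)" using step2 i by (simp add: algebra_simps)
    also have "\<dots> = t" using \<open>\<mu> * \<mu> = 2 * y * \<mu> - 1\<close> by simp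
    finally show ?case using step2 by (simp add: t_def)
  qed
  then show ?thesis by (simp add: g_def \<mu>_def)
qed

lemma deformation_edge_comb_nbr:
  "deformation_of (a *\<^sub>R edge_vec 1 n + b *\<^sub>R edge_vec (-1) n) (slope_of (-1 + k * n) (0 + k * 1)) =
    a * lam powi k + b * inverse lam powi k"
  using deformation_edge_nbr[of 1 n k] deformation_edge_nbr[of "-1" n k]
  by (simp add: deformation_of_lincomb)

lemma edge_comb_nonneg_iff:
  "(\<forall>s. 0 \<le> deformation_of (a *\<^sub>R edge_vec 1 n + b *\<^sub>R edge_vec (-1) n) s) \<longleftrightarrow> 0 \<le> a \<and> 0 \<le> b"
proof
  assume pos: "\<forall>s. 0 \<le> deformation_of (a *\<^sub>R edge_vec 1 n + b *\<^sub>R edge_vec (-1) n) s"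
  have *: "0 \<le> a * lam powi k + b * inverse lam powi k" for k
    using pos[rule_format, of "slope_of (-1 + k * n) (0 + k * 1)"]
    by (simp only: deformation_edge_comb_nbr)
  have **: "0 \<le> a" if *: "\<And>k. 0 \<le> a * lam ^ k + b * inverse lam ^ k" for a b
  proof (rule ccontr)
    assume a: "\<not> 0 \<le> a"
    have "1 < lam\<^sup>2" using lam_gt1 by (simp add: one_less_power)
    then obtain k where k: "b / (- a) < (lam\<^sup>2) ^ k" using real_arch_pow by blast
    \<comment> \<open>After multiplication by lam^k the second term is the constant b, so a negative
      a would win for large k.\<close>
    have "0 \<le> (a * lam ^ k + b * inverse lam ^ k) * lam ^ k"
      using *[of k] lam_gt1 by simp
    also have "\<dots> = a * (lam\<^sup>2) ^ k + b"
      using lam_gt1 by (simp add: distrib_right power_mult_distrib[symmetric] mult.assoc power2_eq_square)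
    finally show False using k a by (simp add: field_simps)
  qed
  show "0 \<le> a \<and> 0 \<le> b"
    using **[of a b] **[of b a] *[of "int _"] *[of "- int _"]
    by (simp add: power_int_minus power_inverse add.commute)
next
  assume ab: "0 \<le> a \<and> 0 \<le> b"
  show "\<forall>s. 0 \<le> deformation_of (a *\<^sub>R edge_vec 1 n + b *\<^sub>R edge_vec (-1) n) s"
  proof
    fix s
    have z: "deformation_of (a *\<^sub>R edge_vec 1 n + b *\<^sub>R edge_vec (-1) n) (slope_of n 1) = 0"
      using deformation_edge_int[of _ n n] by (simp add: deformation_of_lincomb int_slope_eq)
    show "0 \<le> deformation_of (a *\<^sub>R edge_vec 1 n + b *\<^sub>R edge_vec (-1) n) s"
    proof (cases "s = slope_of n 1")
      case True
      then show ?thesis using z by simp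
    next
      case False
      show ?thesis
      proof (rule deformation_ge[OF deformation_of(1), of n 0 1 "-1"])
        fix k
        show "0 \<le> deformation_of (a *\<^sub>R edge_vec 1 n + b *\<^sub>R edge_vec (-1) n) (slope_of (-1 + k * n) (0 + k * 1))"
          using ab lam_gt1 by (simp only: deformation_edge_comb_nbr) simp
      qed (use False z in auto)
    qed
  qed
qed

section \<open>The closure of the positive deformations\<close>

lemma positive_deformations_eq:
  "positive_deformations \<Phi> = {proj v | v. \<forall>s. 0 < deformation_of v s}"
  unfolding positive_deformations_def deform_class_def
  using deformation_of deformation_of_coords by (auto; metis)

lemma region_edge_eq:
  "region_edge \<Phi> s =
    {proj v | v. v \<noteq> 0 \<and> proj v \<in> closure (positive_deformations \<Phi>) \<and> deformation_of v s = 0}"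
  unfolding region_edge_def deform_class_def
  using deformation_of deformation_of_coords by (auto; metis)

text \<open>Two values of opposite signs have a negative product. This condition is open and
  unchanged by scaling, so it defines a neighbourhood in the projective plane, and no positive
  deformation lies in it.\<close>

lemma closure_imp_const_sign:
  assumes "v \<noteq> 0" "proj v \<in> closure (positive_deformations \<Phi>)"
  shows "(\<forall>s. 0 \<le> deformation_of v s) \<or> (\<forall>s. deformation_of v s \<le> 0)"
proof (rule ccontr)
  assume "\<not> ?thesis"
  then obtain s t where st: "deformation_of v s < 0" "0 < deformation_of v t"
    by (auto simp: not_le)
  define W where "W = {w. deformation_of w s * deformation_of w t < 0}"
  have W0: "w \<noteq> 0" if "w \<in> W" for w
    using that deformation_of_scaleR[of 0 w] by (auto simp: W_def)
  have "open W" unfolding W_def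
    by (intro open_Collect_less continuous_on_mult continuous_on_const continuous_deformation_of)
  have sat: "w \<noteq> 0 \<and> proj w \<in> proj ` W \<longleftrightarrow> w \<in> W" for w
  proof
    assume w: "w \<noteq> 0 \<and> proj w \<in> proj ` W"
    then obtain x where x: "x \<in> W" "proj x = proj w" by auto
    then obtain c where "c \<noteq> 0" "w = c *\<^sub>R x" using proj_eq_iff[of x w] w W0 by auto
    moreover have "c * deformation_of x s * (c * deformation_of x t) =
        c\<^sup>2 * (deformation_of x s * deformation_of x t)" by algebra
    moreover have "c\<^sup>2 * (deformation_of x s * deformation_of x t) < 0"
      using x(1) \<open>c \<noteq> 0\<close> by (auto simp: W_def intro: mult_pos_neg)
    ultimately show "w \<in> W" by (simp only: W_def deformation_of_scaleR mem_Collect_eq)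
  qed (use W0 in auto)
  then have "{w. w \<noteq> 0 \<and> proj w \<in> proj ` W} = W" by blast
  then have "open (proj ` W)" using \<open>open W\<close> by (simp add: open_rp2_def)
  moreover have "proj v \<in> proj ` W" using st by (intro imageI) (simp add: W_def mult_neg_pos)
  ultimately have "proj ` W \<inter> positive_deformations \<Phi> \<noteq> {}"
    using assms(2) by (auto simp: closure_iff_nhds_not_empty)
  then obtain x z where x: "x \<in> W" "proj x = proj z" "\<forall>s. 0 < deformation_of z s"
    unfolding positive_deformations_eq by blast
  have "z \<noteq> 0" using x(3) deformation_of_base(1)[of z] by (metis less_irrefl zero_index)
  then have "z \<in> W" using sat[of z] x by (metis imageI)
  moreover have "0 < deformation_of z s * deformation_of z t" using x(3) by simp
  ultimately show False by (simp add: W_def)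
qed

lemma closure_if_perturb:
  assumes "v \<noteq> 0" "\<And>\<epsilon> s. 0 < \<epsilon> \<Longrightarrow> 0 < deformation_of (v + \<epsilon> *\<^sub>R r) s"
  shows "proj v \<in> closure (positive_deformations \<Phi>)"
  unfolding closure_iff_nhds_not_empty
proof (intro allI impI)
  fix A U assume "U \<subseteq> A" "open U" "proj v \<in> U"
  define W where "W = {w. w \<noteq> 0 \<and> proj w \<in> U}"
  have "open W" using \<open>open U\<close> by (simp add: W_def open_rp2_def)
  have "v \<in> W" using assms \<open>proj v \<in> U\<close> by (simp add: W_def)
  have "((\<lambda>\<epsilon>. v + \<epsilon> *\<^sub>R r) \<longlongrightarrow> v + 0 *\<^sub>R r) (at_right 0)"
    by (intro tendsto_intros)
  then have "eventually (\<lambda>\<epsilon>. v + \<epsilon> *\<^sub>R r \<in> W) (at_right 0)"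
    using \<open>open W\<close> \<open>v \<in> W\<close> by (simp add: tendsto_def)
  then have "eventually (\<lambda>\<epsilon>. v + \<epsilon> *\<^sub>R r \<in> W \<and> 0 < \<epsilon>) (at_right 0)"
    by (rule eventually_conj) (rule eventually_at_right_less)
  then obtain \<epsilon> where "v + \<epsilon> *\<^sub>R r \<in> W" "0 < \<epsilon>"
    using eventually_happens'[OF trivial_limit_at_right_real] by blast
  then have "proj (v + \<epsilon> *\<^sub>R r) \<in> U" "proj (v + \<epsilon> *\<^sub>R r) \<in> positive_deformations \<Phi>"
    using assms(2) unfolding positive_deformations_eq by (auto simp: W_def)
  then show "positive_deformations \<Phi> \<inter> A \<noteq> {}" using \<open>U \<subseteq> A\<close> by blast
qed

text \<open>Adding a multiple of \<open>cusp_vec\<close> gives positivity everywhere but at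
  \<open>Infty\<close>, which the assumption on the first coordinate covers.\<close>

lemma closure_if_nonneg:
  fixes v :: "real ^ 3"
  assumes "0 < v $ 1" "\<And>s. 0 \<le> deformation_of v s"
  shows "proj v \<in> closure (positive_deformations \<Phi>)"
proof (rule closure_if_perturb[where r = cusp_vec])
  fix \<epsilon> :: real and s assume \<epsilon>: "0 < \<epsilon>"
  have "deformation_of (v + \<epsilon> *\<^sub>R cusp_vec) s = deformation_of v s + \<epsilon> * deformation_of cusp_vec s"
    using deformation_of_lincomb[of 1 v \<epsilon> cusp_vec s] by simp
  then show "0 < deformation_of (v + \<epsilon> *\<^sub>R cusp_vec) s"
    using assms \<epsilon> deformation_cusp_ge1[of s]
    by (cases "s = Infty") (auto intro!: add_nonneg_pos)
qed (use assms in auto)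

text \<open>Here only the value at \<open>Infty\<close> has to be raised;
  \<open>edge_vec 1 0\<close> does this without lowering any other value.\<close>

lemma cusp_vec_closure: "proj cusp_vec \<in> closure (positive_deformations \<Phi>)"
proof (rule closure_if_perturb[where r = "edge_vec 1 0"])
  show "cusp_vec \<noteq> 0" by (simp add: vec3_eq_iff)
  fix \<epsilon> :: real and s assume \<epsilon>: "0 < \<epsilon>"
  have "deformation_of (cusp_vec + \<epsilon> *\<^sub>R edge_vec 1 0) s =
      deformation_of cusp_vec s + \<epsilon> * deformation_of (edge_vec 1 0) s"
    using deformation_of_lincomb[of 1 cusp_vec \<epsilon> "edge_vec 1 0" s] by simp
  moreover have "0 \<le> deformation_of (edge_vec 1 0) s"
    using edge_comb_nonneg_iff[of 1 0 0] by simp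
  ultimately show "0 < deformation_of (cusp_vec + \<epsilon> *\<^sub>R edge_vec 1 0) s"
    using \<epsilon> deformation_cusp_ge1[of s]
    by (cases "s = Infty") (auto intro!: add_pos_nonneg)
qed

section \<open>The edges: a point for R, segments for its neighbours\<close>

lemma region_edge_Infty: "region_edge \<Phi> Infty = {proj cusp_vec}"
proof -
  have nz: "cusp_vec \<noteq> 0" by (simp add: vec3_eq_iff)
  have "proj v = proj cusp_vec"
    if v: "v \<noteq> 0" "proj v \<in> closure (positive_deformations \<Phi>)" "deformation_of v Infty = 0" for v
  proof -
    have lin: "deformation_of v (int_slope n) = (v $ 3 - v $ 2) * of_int n + v $ 2" for n
      using v(3) by (simp add: deformation_of_int)
    define \<delta> where "\<delta> = v $ 3 - v $ 2"
    \<comment> \<open>A nonconstant affine sequence on the integers takes both signs.\<close>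
    have "\<delta> = 0"
    proof (rule ccontr)
      assume "\<delta> \<noteq> 0"
      obtain k :: int where k: "- v $ 2 / \<delta> < of_int k" using ex_less_of_int by blast
      obtain j :: int where j: "of_int j < - v $ 2 / \<delta>" using ex_of_int_less by blast
      have "(\<delta> * of_int k + v $ 2 < 0 \<and> 0 < \<delta> * of_int j + v $ 2) \<or>
        (0 < \<delta> * of_int k + v $ 2 \<and> \<delta> * of_int j + v $ 2 < 0)"
        using \<open>\<delta> \<noteq> 0\<close> k j by (cases "\<delta> > 0") (auto simp: field_simps)
      then show False using closure_imp_const_sign[OF v(1,2)] lin
        unfolding \<delta>_def by (metis linorder_not_less)
    qed
    then have "v = (v $ 2) *\<^sub>R cusp_vec" using v(3) by (simp add: vec3_eq_iff \<delta>_def)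
    then show ?thesis using v(1) nz proj_scaleR[of "v $ 2" cusp_vec] by (metis scaleR_zero_left)
  qed
  moreover have "deformation_of cusp_vec Infty = 0" by simp
  ultimately show ?thesis unfolding region_edge_eq using cusp_vec_closure nz by blast
qed

lemma edge_vec_span:
  assumes "deformation_of v (int_slope n) = 0"
  obtains a b where "v = a *\<^sub>R edge_vec 1 n + b *\<^sub>R edge_vec (-1) n"
proof -
  define b where "b = v $ 3 - v $ 2 - y * v $ 1"
  \<comment> \<open>The numerator is the derivative at n of the quadratic k \<mapsto> \<phi>(R_k).
    For \<open>edge_vec \<sigma> n\<close> this derivative is - \<sigma> sh, so \<delta> must be q -
    p for the coefficients p and q below.\<close>
  define \<delta> where "\<delta> = (b + 2 * y * v $ 1 * of_int n) / sh"
  have \<delta>: "\<delta> * sh = b + 2 * y * v $ 1 * of_int n" using sh_pos by (simp add: \<delta>_def)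
  have \<gamma>: "v $ 2 = - y * v $ 1 * (of_int n)\<^sup>2 - b * of_int n"
    using assms by (simp add: deformation_of_int b_def)
  have v3: "v $ 3 = b + v $ 2 + y * v $ 1" by (simp add: b_def)
  define p q where "p = (v $ 1 - \<delta>) / 2" and "q = (v $ 1 + \<delta>) / 2"
  have pq: "p + q = v $ 1" "(p - q) * sh = - (b + 2 * y * v $ 1 * of_int n)"
    using \<delta> by (simp_all add: p_def q_def field_simps)
  have "p * (y * (of_int n)\<^sup>2 + sh * of_int n) + q * (y * (of_int n)\<^sup>2 - sh * of_int n) =
      (p + q) * (y * (of_int n)\<^sup>2) + ((p - q) * sh) * of_int n" by (simp add: algebra_simps)
  also have "\<dots> = v $ 2" unfolding pq \<gamma> by (simp add: algebra_simps power2_eq_square)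
  finally have "v $ 2 = p * (y * (of_int n)\<^sup>2 + sh * of_int n) + q * (y * (of_int n)\<^sup>2 - sh * of_int n)"
    by simp
  moreover have "p * (y * (1 - of_int n)\<^sup>2 - sh * (1 - of_int n)) +
      q * (y * (1 - of_int n)\<^sup>2 + sh * (1 - of_int n)) =
      (p + q) * (y * (1 - of_int n)\<^sup>2) - ((p - q) * sh) * (1 - of_int n)" by (simp add: algebra_simps)
  then have "v $ 3 = p * (y * (1 - of_int n)\<^sup>2 - sh * (1 - of_int n)) +
      q * (y * (1 - of_int n)\<^sup>2 + sh * (1 - of_int n))"
    unfolding pq v3 \<gamma> by (simp add: algebra_simps power2_eq_square)
  ultimately have "v = p *\<^sub>R edge_vec 1 n + q *\<^sub>R edge_vec (-1) n"
    unfolding vec3_eq_iff using pq(1) by simp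
  then show thesis by (rule that)
qed

lemma edge_vec_nonzero: "edge_vec \<sigma> n \<noteq> 0"
  by (simp add: vec3_eq_iff)

lemma edge_vec_proj_distinct: "proj (edge_vec 1 n) \<noteq> proj (edge_vec (-1) n)"
proof
  assume "proj (edge_vec 1 n) = proj (edge_vec (-1) n)"
  then obtain c where c: "edge_vec (-1) n = c *\<^sub>R edge_vec 1 n"
    using proj_eq_iff[OF edge_vec_nonzero edge_vec_nonzero] by blast
  then have "c = 1" unfolding vec3_eq_iff by simp
  then have "deformation_of (edge_vec (-1) n) (int_slope (n + 1)) =
      deformation_of (edge_vec 1 n) (int_slope (n + 1))" using c by simp
  then show False using sh_pos by (simp add: deformation_edge_int)
qed

lemma segment_region_edge:
  "segment_with_endpoints (region_edge \<Phi> (int_slope n)) (proj (edge_vec 1 n)) (proj (edge_vec (-1) n))"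
proof -
  let ?u = "edge_vec 1 n" and ?w = "edge_vec (-1) n"
  have "region_edge \<Phi> (int_slope n) =
      {proj (a *\<^sub>R ?u + b *\<^sub>R ?w) | a b. 0 \<le> a \<and> 0 \<le> b \<and> (a \<noteq> 0 \<or> b \<noteq> 0)}"
  proof (intro Set.set_eqI iffI)
    fix x assume "x \<in> region_edge \<Phi> (int_slope n)"
    then obtain v where v: "v \<noteq> 0" "proj v \<in> closure (positive_deformations \<Phi>)"
        "deformation_of v (int_slope n) = 0" "x = proj v"
      unfolding region_edge_eq by blast
    \<comment> \<open>The sign \<tau> selects the nonnegative representative of the class, and
      thereby the right one of the two segments with these endpoints.\<close>
    obtain \<tau> where \<tau>: "\<tau> = 1 \<or> \<tau> = - 1" "\<forall>s. 0 \<le> deformation_of (\<tau> *\<^sub>R v) s"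
    proof (cases "\<forall>s. 0 \<le> deformation_of v s")
      case True then show ?thesis by (intro that[of 1]) auto
    next
      case False then show ?thesis
        using closure_imp_const_sign[OF v(1,2)] deformation_of_scaleR[of "-1" v]
        by (intro that[of "-1"]) auto
    qed
    have "deformation_of (\<tau> *\<^sub>R v) (int_slope n) = 0" using v(3) by (simp add: deformation_of_scaleR)
    then obtain a b where ab: "\<tau> *\<^sub>R v = a *\<^sub>R ?u + b *\<^sub>R ?w" by (rule edge_vec_span)
    then have "0 \<le> a \<and> 0 \<le> b" using \<tau>(2) edge_comb_nonneg_iff by simp
    moreover have "a \<noteq> 0 \<or> b \<noteq> 0" using ab v(1) \<tau>(1) by auto
    moreover have "x = proj (a *\<^sub>R ?u + b *\<^sub>R ?w)"
      unfolding ab[symmetric] v(4) using \<tau>(1) v(1) by (intro proj_scaleR[symmetric]) auto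
    ultimately show "x \<in> {proj (a *\<^sub>R ?u + b *\<^sub>R ?w) | a b. 0 \<le> a \<and> 0 \<le> b \<and> (a \<noteq> 0 \<or> b \<noteq> 0)}"
      by blast
  next
    fix x assume "x \<in> {proj (a *\<^sub>R ?u + b *\<^sub>R ?w) | a b. 0 \<le> a \<and> 0 \<le> b \<and> (a \<noteq> 0 \<or> b \<noteq> 0)}"
    then obtain a b where x: "x = proj (a *\<^sub>R ?u + b *\<^sub>R ?w)" and ab: "0 \<le> a" "0 \<le> b" "a \<noteq> 0 \<or> b \<noteq> 0"
      by blast
    have pos: "0 < (a *\<^sub>R ?u + b *\<^sub>R ?w) $ 1" using ab by auto
    then have "a *\<^sub>R ?u + b *\<^sub>R ?w \<noteq> 0" by (metis less_irrefl zero_index)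
    moreover have "x \<in> closure (positive_deformations \<Phi>)"
      unfolding x using edge_comb_nonneg_iff ab by (intro closure_if_nonneg[OF pos]) blast
    moreover have "deformation_of (a *\<^sub>R ?u + b *\<^sub>R ?w) (int_slope n) = 0"
      by (simp add: deformation_of_lincomb deformation_edge_int)
    ultimately show "x \<in> region_edge \<Phi> (int_slope n)" unfolding region_edge_eq x by blast
  qed
  then show ?thesis unfolding segment_with_endpoints_def
    using edge_vec_nonzero edge_vec_proj_distinct by blast
qed

end

section \<open>Intersection multiplicity with a graph\<close>

text \<open>A graph y = q(x) through the origin preserves values there, so denominators of the local
  ring stay invertible after restriction to it.\<close>

lemma poly_poly_0:
  assumes "poly q 0 = 0"
  shows "poly (poly F q) 0 = poly (poly F 0) (0 :: 'a::comm_semiring_0)"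
  using assms by (cases F) simp

text \<open>The c i are the first coefficients of the power series p / w; each new one cancels the
  constant term of the remainder.\<close>

lemma division_up_to_order:
  fixes p w :: "'a::field poly"
  assumes "poly w 0 \<noteq> 0"
  shows "\<exists>c. monom 1 m dvd p - (\<Sum>i<m. monom (c i) i) * w"
proof (induction m)
  case 0
  then show ?case by simp
next
  case (Suc m)
  then obtain c r where r: "p - (\<Sum>i<m. monom (c i) i) * w = monom 1 m * r" by (auto simp: dvd_def)
  define k where "k = poly r 0 / poly w 0"
  define c' where "c' = c(m := k)"
  have "poly (r - smult k w) 0 = 0" using assms by (simp add: k_def)
  then obtain r' where r': "r - smult k w = [:0, 1:] * r'" by (metis poly_eq_0_iff_dvd minus_zero dvdE)
  have sm: "(\<Sum>i<m. monom (c' i) i) = (\<Sum>i<m. monom (c i) i)" by (simp add: c'_def)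
  have "p - (\<Sum>i<Suc m. monom (c' i) i) * w = monom 1 m * r - monom k m * w"
    using r by (simp add: sm c'_def algebra_simps)
  also have "monom k m = smult k (monom 1 m)" by (simp add: smult_monom)
  also have "monom 1 m * r - smult k (monom 1 m) * w = monom 1 m * (r - smult k w)"
    by (simp add: algebra_simps)
  also have "\<dots> = monom 1 (Suc m) * r'" unfolding r' by (simp add: monom_Suc)
  finally show ?case by (metis dvd_triv_left)
qed

lemma monom_dvd_mult_cancel:
  fixes p u :: "'a::field poly"
  assumes "monom 1 m dvd p * u" "poly u 0 \<noteq> 0"
  shows "monom 1 m dvd p"
proof (cases "p = 0")
  case False
  have "u \<noteq> 0" using assms(2) by auto
  then have "p * u \<noteq> 0" using False by simp
  moreover have "order 0 u = 0" using assms(2) by (simp add: order_0I)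
  ultimately show ?thesis using assms(1) False by (simp add: monom_1_dvd_iff order_mult)
qed simp

lemma local_ring_origin_diff:
  assumes "h \<in> local_ring_origin" "k \<in> local_ring_origin"
  shows "h - k \<in> local_ring_origin"
proof -
  obtain a b c d where h: "h = Fract a b" "poly (poly b 0) 0 \<noteq> 0"
    and k: "k = Fract c d" "poly (poly d 0) 0 \<noteq> 0"
    using assms unfolding local_ring_origin_def by blast
  have nz: "b \<noteq> 0" "d \<noteq> 0" using h k by auto
  then have "h - k = Fract (a * d - c * b) (b * d)" using h k by simp
  moreover have "poly (poly (b * d) 0) 0 \<noteq> 0" using h k by simp
  ultimately show ?thesis unfolding local_ring_origin_def by blast
qed

lemma Fract_monom_sum:
  "(\<Sum>i<m. Fract [:[:c i:]:] 1 * Fract [:monom 1 i:] 1) =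
     (Fract [:\<Sum>i<m. monom (c i) i:] 1 :: 'a::field poly poly fract)"
proof (induction m)
  case 0
  then show ?case by (simp add: Zero_fract_def)
next
  case (Suc m)
  have "Fract [:[:c m:]:] 1 * Fract [:monom 1 m:] 1 = (Fract [:monom (c m) m:] 1 :: 'a poly poly fract)"
    by (simp add: smult_monom)
  then show ?case using Suc by simp
qed

text \<open>The curve \<open>g = 0\<close> is the graph \<open>y = q(x)\<close>; restriction to it identifies the quotient by \<open>f\<close> and
  \<open>g\<close> with \<open>\<real>[x]\<close> modulo \<open>x\<^sup>m\<close>.\<close>

lemma intersection_multiplicity_graph:
  assumes g: "g = [:q, -1:]" and q: "poly q 0 = 0"
    and f: "poly f q = monom 1 m * e" and e: "poly e 0 \<noteq> 0"
  shows "intersection_multiplicity_origin f g m"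
  unfolding intersection_multiplicity_origin_def
proof (intro exI[of _ "\<lambda>i. Fract [:monom 1 i:] 1"] conjI allI impI ballI)
  fix i show "Fract [:monom 1 i:] 1 \<in> local_ring_origin"
    unfolding local_ring_origin_def by (intro CollectI exI[of _ "[:monom 1 i:]"] exI[of _ 1]) simp
next
  fix h assume "h \<in> local_ring_origin"
  then obtain F G where h: "h = Fract F G" and G0: "poly (poly G 0) 0 \<noteq> 0"
    unfolding local_ring_origin_def by blast
  have G: "G \<noteq> 0" using G0 by auto
  have gq: "poly g q = 0" by (simp add: g)
  \<comment> \<open>On the graph g vanishes and f becomes x^m e. This gives the uniqueness of the
    coefficients.\<close>
  have in_ideal: "monom 1 m dvd poly P q" if P: "Fract P 1 \<in> local_ideal f g" for P
  proof -
    obtain A B C D where PF: "Fract P 1 = Fract A B * Fract f 1 + Fract C D * Fract g 1"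
      and B: "poly (poly B 0) 0 \<noteq> 0" and D: "poly (poly D 0) 0 \<noteq> 0"
      using P unfolding local_ideal_def local_ring_origin_def by blast
    have "B \<noteq> 0" "D \<noteq> 0" using B D by auto
    then have "P * (B * D) = A * f * D + C * g * B" using PF by (simp add: eq_fract)
    then have "poly (P * (B * D)) q = poly (A * f * D + C * g * B) q" by simp
    then have "poly P q * poly (B * D) q = monom 1 m * (e * poly A q * poly D q)"
      by (simp add: f gq mult_ac)
    moreover have "poly (poly (B * D) q) 0 \<noteq> 0" using B D by (simp add: poly_poly_0[OF q])
    ultimately show ?thesis by (metis monom_dvd_mult_cancel dvd_triv_left)
  qed
  have "poly (poly G q) 0 \<noteq> 0" using G0 by (simp add: poly_poly_0[OF q])
  then obtain c0 where "monom 1 m dvd poly F q - (\<Sum>i<m. monom (c0 i) i) * poly G q"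
    using division_up_to_order by blast
  then obtain r where r: "poly F q - (\<Sum>i<m. monom (c0 i) i) * poly G q = monom 1 m * r"
    by (auto simp: dvd_def)
  define c where "c i = (if i < m then c0 i else 0)" for i
  define C where "C = (\<Sum>i<m. monom (c i) i)"
  have C: "C = (\<Sum>i<m. monom (c0 i) i)" by (simp add: C_def c_def)
  have mem: "h - Fract [:C:] 1 \<in> local_ideal f g"
  proof -
    \<comment> \<open>On the graph F - C G is x^m r and f is x^m e, so this combination vanishes and
      is divisible by y - q(x). As e is a unit at the origin, F - C G lies in the local
      ideal.\<close>
    have "poly ([:e:] * (F - [:C:] * G) - [:r:] * f) q = 0"
      using r[folded C] by (simp add: f algebra_simps)
    then obtain H where H: "[:e:] * (F - [:C:] * G) - [:r:] * f = [:- q, 1:] * H"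
      unfolding poly_eq_0_iff_dvd dvd_def by blast
    have mg: "[:- q, 1:] = - g" by (simp add: g)
    have eq: "[:e:] * (F - [:C:] * G) = [:r:] * f - H * g" using H unfolding mg by (simp add: algebra_simps)
    have e0: "[:e:] * G \<noteq> 0" using e G by auto
    have "Fract [:r:] ([:e:] * G) * Fract f 1 + Fract (- H) ([:e:] * G) * Fract g 1 =
        Fract ([:r:] * f * ([:e:] * G) + - H * g * ([:e:] * G)) (([:e:] * G) * ([:e:] * G))"
      using e0 by simp
    also have "[:r:] * f * ([:e:] * G) + - H * g * ([:e:] * G) = ([:e:] * G) * ([:r:] * f - H * g)"
      by algebra
    also have "Fract \<dots> (([:e:] * G) * ([:e:] * G)) = Fract ([:e:] * (F - [:C:] * G)) ([:e:] * G)"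
      unfolding eq[symmetric] using e0 by (rule mult_fract_cancel)
    also have "\<dots> = Fract (F - [:C:] * G) G" using e by (intro mult_fract_cancel) auto
    also have "\<dots> = h - Fract [:C:] 1" using G by (simp add: h)
    finally have "h - Fract [:C:] 1 =
      Fract [:r:] ([:e:] * G) * Fract f 1 + Fract (- H) ([:e:] * G) * Fract g 1" by simp
    moreover have "poly (poly ([:e:] * G) 0) 0 \<noteq> 0" using e G0 by simp
    ultimately show ?thesis
      unfolding local_ideal_def local_ring_origin_def by blast
  qed
  show "\<exists>!c. (\<forall>i\<ge>m. c i = 0) \<and>
      h - (\<Sum>i<m. Fract [:[:c i:]:] 1 * Fract [:monom 1 i:] 1) \<in> local_ideal f g"
    unfolding Fract_monom_sum
  proof (rule ex1I[of _ c])
    show "(\<forall>i\<ge>m. c i = 0) \<and> h - Fract [:\<Sum>i<m. monom (c i) i:] 1 \<in> local_ideal f g"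
      using mem by (simp add: C_def c_def)
  next
    fix c' assume c': "(\<forall>i\<ge>m. c' i = 0) \<and> h - Fract [:\<Sum>i<m. monom (c' i) i:] 1 \<in> local_ideal f g"
    define C' where "C' = (\<Sum>i<m. monom (c' i) i)"
    obtain A B where AB: "A \<in> local_ring_origin" "B \<in> local_ring_origin"
        "h - Fract [:C:] 1 = A * Fract f 1 + B * Fract g 1"
      using mem unfolding local_ideal_def by blast
    obtain A' B' where AB': "A' \<in> local_ring_origin" "B' \<in> local_ring_origin"
        "h - Fract [:C':] 1 = A' * Fract f 1 + B' * Fract g 1"
      using c' unfolding local_ideal_def C'_def by blast
    have "Fract [:C - C':] 1 = Fract [:C:] 1 - (Fract [:C':] 1 :: real poly poly fract)" by simp
    also have "\<dots> = (h - Fract [:C':] 1) - (h - Fract [:C:] 1)" by simp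
    also have "\<dots> = (A' - A) * Fract f 1 + (B' - B) * Fract g 1"
      unfolding AB AB' by (simp add: algebra_simps)
    finally have "Fract [:C - C':] 1 \<in> local_ideal f g"
      using local_ring_origin_diff[OF AB'(1) AB(1)] local_ring_origin_diff[OF AB'(2) AB(2)]
      unfolding local_ideal_def by blast
    then have "monom 1 m dvd C - C'" using in_ideal by fastforce
    then have "coeff (C - C') i = 0" if "i < m" for i using that by (simp add: monom_1_dvd_iff')
    moreover have "coeff C i = c i" "coeff C' i = c' i" if "i < m" for i
      using that by (simp_all add: C_def C'_def coeff_sum coeff_monom)
    ultimately have "c' i = c i" if "i < m" for i using that by simp
    then show "c' = c" using c' by (metis c_def ext linorder_not_less)
  qed
qed

section \<open>The two conics\<close>

text \<open>In the coordinates \<open>a = \<phi>(R)\<close>, \<open>c = \<phi>(R\<^sub>0)\<close>, \<open>b = \<phi>(R\<^sub>1) - \<phi>(R\<^sub>0) - y a\<close>, for which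
  \<open>\<phi>(R\<^sub>n) = y a n\<^sup>2 + b n + c\<close>, the quadratic form is \<open>b\<^sup>2 - 4 y a c + (t - y\<^sup>2) a\<^sup>2\<close>. At \<open>t = y\<^sup>2\<close> it is
  the discriminant of \<open>n \<mapsto> \<phi>(R\<^sub>n)\<close>.\<close>

definition pencil_matrix :: "real \<Rightarrow> real \<Rightarrow> real ^ 3 ^ 3" where
  "pencil_matrix y t = vector [vector [t, - y, - y], vector [- y, 1, - 1], vector [- y, - 1, 1]]"

lemma pencil_matrix_nth [simp]:
  "pencil_matrix y t $ 1 $ 1 = t" "pencil_matrix y t $ 1 $ 2 = - y" "pencil_matrix y t $ 1 $ 3 = - y"
  "pencil_matrix y t $ 2 $ 1 = - y" "pencil_matrix y t $ 2 $ 2 = 1" "pencil_matrix y t $ 2 $ 3 = - 1"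
  "pencil_matrix y t $ 3 $ 1 = - y" "pencil_matrix y t $ 3 $ 2 = - 1" "pencil_matrix y t $ 3 $ 3 = 1"
  by (simp_all add: pencil_matrix_def)

lemma nondegenerate_pencil: "y \<noteq> 0 \<Longrightarrow> nondegenerate_conic (pencil_matrix y t)"
  by (simp add: nondegenerate_conic_def det_3 vec_eq_iff forall_3 transpose_def)

lemma pencil_form:
  "w \<bullet> (pencil_matrix y t *v v) =
    t * w $ 1 * v $ 1 - y * (w $ 1 * (v $ 2 + v $ 3) + v $ 1 * (w $ 2 + w $ 3)) +
    (w $ 2 - w $ 3) * (v $ 2 - v $ 3)"
  for v w :: "real ^ 3"
  by (simp add: inner_vec_def matrix_vector_mult_def sum_3 algebra_simps)

text \<open>The two forms differ by a multiple of a^2. On the second conic, parametrized near r by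
  x, the coordinate a is proportional to x^2, so the first form restricts to a nonzero multiple of
  x^4.\<close>

lemma pencil_contact:
  assumes "y \<noteq> 0" "t \<noteq> y\<^sup>2"
  shows "conic_intersection_multiplicity (pencil_matrix y t) (pencil_matrix y (y\<^sup>2))
    (proj (vector [0, 1, 1])) 4"
  unfolding conic_intersection_multiplicity_def
proof (intro exI conjI)
  \<comment> \<open>The point x u + y' w + v, with y' the second chart variable, has b = x, c = 1
    and a = y' / (4 y), so the discriminant b^2 - 4 y a c becomes x^2 - y'.\<close>
  let ?u = "vector [0, 0, 1] :: real^3" and ?w = "vector [1 / (4 * y), 0, 1 / 4] :: real^3"
    and ?v = "vector [0, 1, 1] :: real^3"
  show "det (vector [?u, ?w, ?v] :: real^3^3) \<noteq> 0"
    using assms by (simp add: det_3)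
  show "proj ?v = proj ?v" ..
  have eq: "conic_chart_equation (pencil_matrix y t) ?u ?w ?v =
      [:[:0, 0, 1:], -1, [:(t - y\<^sup>2) / (16 * y\<^sup>2):]:]" for t
    using assms(1)
    by (simp add: conic_chart_equation_def Let_def sum_3 numeral_poly one_pCons field_simps power2_eq_square)
  show "intersection_multiplicity_origin (conic_chart_equation (pencil_matrix y t) ?u ?w ?v)
      (conic_chart_equation (pencil_matrix y (y\<^sup>2)) ?u ?w ?v) 4"
  proof (rule intersection_multiplicity_graph)
    show "conic_chart_equation (pencil_matrix y (y\<^sup>2)) ?u ?w ?v = [:[:0, 0, 1:], -1:]"
      unfolding eq by simp
    show "poly (conic_chart_equation (pencil_matrix y t) ?u ?w ?v) [:0, 0, 1:] =
        monom 1 4 * [:(t - y\<^sup>2) / (16 * y\<^sup>2):]"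
      unfolding eq by (simp add: monom_altdef eval_nat_numeral)
  qed (use assms in auto)
qed

context cusp_markoff_map
begin

text \<open>The quadratic y (k - n)^2 - \<sigma> sh (k - n) has discriminant sh^2 = y^2 - 1 and a =
  1; the parameter t = 1 is the one for which t - y^2 cancels it.\<close>

lemma edge_vec_on_conic:
  assumes "\<sigma> = 1 \<or> \<sigma> = - 1"
  shows "proj (edge_vec \<sigma> n) \<in> conic_points (pencil_matrix y 1)"
proof -
  have "edge_vec \<sigma> n \<bullet> (pencil_matrix y 1 *v edge_vec \<sigma> n) = sh\<^sup>2 - y\<^sup>2 + 1"
    using assms unfolding pencil_form by (auto simp: algebra_simps power2_eq_square)
  then show ?thesis using edge_vec_nonzero by (auto simp: conic_points_def sh_square)
qed

lemma proj_in_edge_line_iff: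
  assumes "w \<noteq> 0"
  shows "proj w \<in> line_through (proj (edge_vec 1 n)) (proj (edge_vec (-1) n)) \<longleftrightarrow>
    deformation_of w (int_slope n) = 0"
proof -
  have "proj w \<in> line_through (proj (edge_vec 1 n)) (proj (edge_vec (-1) n)) \<longleftrightarrow>
      w \<in> span (span {edge_vec 1 n} \<union> span {edge_vec (-1) n})"
    using span_base[of w "{w}"] span_minimal[of "{w}", OF _ subspace_span]
    by (auto simp: line_through_def Rep_proj assms edge_vec_nonzero)
  also have "\<dots> \<longleftrightarrow> (\<exists>a b. w = a *\<^sub>R edge_vec 1 n + b *\<^sub>R edge_vec (-1) n)"
    by (auto simp: span_Un span_span) (auto simp: span_singleton)
  also have "\<dots> \<longleftrightarrow> deformation_of w (int_slope n) = 0"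
    using edge_vec_span by (auto simp: deformation_of_lincomb deformation_edge_int; metis)
  finally show ?thesis .
qed

text \<open>The midpoint \<open>edge_vec 0 n\<close> of the edge is the deformation whose values \<open>y (k - n)\<^sup>2\<close> on the
  \<open>R\<^sub>k\<close> have a double root at \<open>n\<close>; it is the point of tangency.\<close>

lemma edge_line_tangent:
  "tangent_to_conic (line_through (proj (edge_vec 1 n)) (proj (edge_vec (-1) n)))
    (pencil_matrix y (y\<^sup>2))"
  unfolding tangent_to_conic_def
proof (intro exI conjI)
  \<comment> \<open>Polarizing the discriminant at a quadratic with double root n gives a multiple
    of evaluation at n, so the tangent line is the line of quadratics vanishing there.\<close>
  have polar: "w \<bullet> (pencil_matrix y (y\<^sup>2) *v edge_vec 0 n) = - 2 * y * deformation_of w (int_slope n)" for w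
    unfolding pencil_form deformation_of_int by (simp add: algebra_simps power2_eq_square)
  show "edge_vec 0 n \<noteq> 0" by (rule edge_vec_nonzero)
  show "edge_vec 0 n \<bullet> (pencil_matrix y (y\<^sup>2) *v edge_vec 0 n) = 0"
    unfolding polar by (simp add: deformation_edge_int)
  show "line_through (proj (edge_vec 1 n)) (proj (edge_vec (-1) n)) =
      {proj w | w. w \<noteq> 0 \<and> w \<bullet> (pencil_matrix y (y\<^sup>2) *v edge_vec 0 n) = 0}"
  proof (intro Set.set_eqI)
    fix x :: rp2
    obtain w where w: "w \<noteq> 0" "x = proj w" by (rule rp2_obtain)
    have "(\<exists>w'. proj w = proj w' \<and> w' \<noteq> 0 \<and> deformation_of w' (int_slope n) = 0) \<longleftrightarrow>
        deformation_of w (int_slope n) = 0"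
      using w(1) proj_in_edge_line_iff by metis
    then show "x \<in> line_through (proj (edge_vec 1 n)) (proj (edge_vec (-1) n)) \<longleftrightarrow>
       x \<in> {proj w | w. w \<noteq> 0 \<and> w \<bullet> (pencil_matrix y (y\<^sup>2) *v edge_vec 0 n) = 0}"
      using y_gt1 w proj_in_edge_line_iff[OF w(1)] unfolding polar by simp
  qed
qed

lemma edges_of_positive_deformations:
  "\<exists>\<rho>. inf_deformation \<Phi> \<rho> \<and> \<rho> Infty = 0 \<and> (\<forall>n. \<rho> (int_slope n) = 1) \<and>
       region_edge \<Phi> Infty = {deform_class \<rho>} \<and>
       (\<exists>A B. nondegenerate_conic A \<and> nondegenerate_conic B \<and>
          deform_class \<rho> \<in> conic_points A \<and>
          (\<forall>n. \<exists>p q. segment_with_endpoints (region_edge \<Phi> (int_slope n)) p q \<and>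
             p \<in> conic_points A \<and> q \<in> conic_points A \<and>
             tangent_to_conic (line_through p q) B) \<and>
          conic_intersection_multiplicity A B (deform_class \<rho>) 4)"
proof (intro exI conjI allI)
  have cls: "deform_class (deformation_of cusp_vec) = proj cusp_vec"
    by (simp add: deform_class_def deformation_of)
  have "1 < y\<^sup>2" using y_gt1 by (simp add: one_less_power)
  then have y0: "y \<noteq> 0" "1 \<noteq> y\<^sup>2" using y_gt1 by linarith+
  show "inf_deformation \<Phi> (deformation_of cusp_vec)" by (rule deformation_of)
  show "deformation_of cusp_vec Infty = 0" by simp
  show "deformation_of cusp_vec (int_slope n) = 1" for n by simp
  show "region_edge \<Phi> Infty = {deform_class (deformation_of cusp_vec)}"
    unfolding cls by (rule region_edge_Infty)
  show "nondegenerate_conic (pencil_matrix y 1)" "nondegenerate_conic (pencil_matrix y (y\<^sup>2))"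
    using y0 by (simp_all add: nondegenerate_pencil)
  have "cusp_vec \<noteq> 0" by (simp add: vec3_eq_iff)
  moreover have "cusp_vec \<bullet> (pencil_matrix y 1 *v cusp_vec) = 0" by (simp add: pencil_form)
  ultimately show "deform_class (deformation_of cusp_vec) \<in> conic_points (pencil_matrix y 1)"
    unfolding cls conic_points_def by blast
  show "segment_with_endpoints (region_edge \<Phi> (int_slope n)) (proj (edge_vec 1 n)) (proj (edge_vec (-1) n))"
    "proj (edge_vec 1 n) \<in> conic_points (pencil_matrix y 1)"
    "proj (edge_vec (-1) n) \<in> conic_points (pencil_matrix y 1)"
    "tangent_to_conic (line_through (proj (edge_vec 1 n)) (proj (edge_vec (-1) n))) (pencil_matrix y (y\<^sup>2))"
    for n
    by (rule segment_region_edge edge_line_tangent | simp add: edge_vec_on_conic)+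
  show "conic_intersection_multiplicity (pencil_matrix y 1) (pencil_matrix y (y\<^sup>2))
      (deform_class (deformation_of cusp_vec)) 4"
    unfolding cls using pencil_contact[OF y0] by (simp add: cusp_vec_def)
qed

end

theorem theorem6p1:
  fixes \<Phi> :: "slope \<Rightarrow> real"
  assumes "markoff_map \<Phi>"
    and "\<forall>s. \<Phi> s \<ge> 2"
    and "\<forall>s. \<Phi> s = 2 \<longleftrightarrow> s = Infty"
  shows "(\<exists>y>1. \<forall>n. \<Phi> (int_slope n) = 2 * y) \<and>
    (\<exists>\<rho>. inf_deformation \<Phi> \<rho> \<and> \<rho> Infty = 0 \<and> (\<forall>n. \<rho> (int_slope n) = 1) \<and>
       region_edge \<Phi> Infty = {deform_class \<rho>} \<and>
       (\<exists>A B. nondegenerate_conic A \<and> nondegenerate_conic B \<and>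
          deform_class \<rho> \<in> conic_points A \<and>
          (\<forall>n. \<exists>p q. segment_with_endpoints (region_edge \<Phi> (int_slope n)) p q \<and>
             p \<in> conic_points A \<and> q \<in> conic_points A \<and>
             tangent_to_conic (line_through p q) B) \<and>
          conic_intersection_multiplicity A B (deform_class \<rho>) 4))"
proof -
  define y where "y = \<Phi> (int_slope 0) / 2"
  have int: "\<Phi> (int_slope n) = 2 * y" for n
    using markoff_map_int_slopes_eq[OF assms(1,2), of n] assms(3) by (simp add: y_def)
  have "\<Phi> (int_slope 0) \<noteq> 2" using assms(3) by (simp add: int_slope_def)
  then have y: "1 < y" using assms(2) by (simp add: y_def order_less_le)
  interpret cusp_markoff_map \<Phi> y
    by unfold_locales (use assms int y in auto)
  show ?thesis using int y edges_of_positive_deformations by blast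
qed

end
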